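(* Let $n\ge 4$ be an even integer, $K$ a field, and $T=K[x_1,\ldots,x_n,y_1,\ldots,y_n]$, with indices of the $x$- and $y$-variables taken modulo $n$ (so $x_0=x_n$, $y_0=y_n$). Let $$f_j=x_{j-2}y_j-x_jy_{j+1}\quad (j=1,\ldots,n-1),$$ $$g_k=x_{2k-2}\prod_{\substack{i\in[0,2k)\\ i\text{ odd}}}y_i-x_{n-2}\prod_{\substack{i\in[0,2k)\\ i\text{ even}}}y_i\quad (k=1,\ldots,n/2),$$ $$h=\prod_{\substack{i\in[0,n)\\ i\text{ odd}}}y_i-\prod_{\substack{i\in[0,n)\\ i\text{ even}}}y_i .$$ Let $L$ be the defining ideal of the symmetric algebra of $I_{n-2}(C_n)$ and let $H=(h)\subset K[y_1,\ldots,y_n]$. Then the polynomials $\{f_1,\ldots,f_{n-1},g_1,\ldots,g_{n/2},h\}$ form a Gröbner basis of $L+HT$ with respect to any monomial order on $T$ which is the product order of $<_1$ and $<_2$, where $<_1$ is the reverse lexicographic order on $K[y_1,\ldots,y_n]$ induced by $y_1>y_2>\cdots>y_{n-1}>y_0$, and $<_2$ is an arbitrary monomial order on $K[x_1,\ldots,x_n]$.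
   Context: Let $S=K[x_1,\ldots,x_n]$. $I_{n-2}(C_n)\subset S$ is the $(n-2)$-path ideal of the $n$-cycle, generated by the monomials $u_j=x_jx_{j+1}\cdots x_{j+n-3}$, $j=1,\ldots,n$ (indices modulo $n$). The defining ideal $L\subset T=S[y_1,\ldots,y_n]$ of the symmetric algebra of $I_{n-2}(C_n)$ is the ideal generated by all $\sum_i a_iy_i$ with $a_i\in S$ and $\sum_i a_iu_i=0$; it is known (Brumatti–da Silva) that $L=(f_1,\ldots,f_{n-1},g_1)$. Integer intervals are ordinary intervals (not modulo $n$). The reverse lexicographic order is the usual graded one: monomials are compared first by degree, ties broken reverse lexicographically. The product order of $<_1$ and $<_2$ compares the $y$-parts first: for monomials $u,u'$ in the $x$'s and $v,v'$ in the $y$'s, $uv<u'v'$ iff $v<_1v'$, or $v=v'$ and $u<_2u'$. *)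

theory Defs
  imports "HOL-Library.Poly_Mapping" "HOL-Algebra.Ideal"
begin

text \<open>
  The number \<open>n\<close> of variables of each kind is a term, not a type, so polynomials live over the
  fixed variable type below, and \<open>K[V]\<close> is cut out of it as the ring of polynomials involving only
  variables from a set \<open>V\<close>. Monomials are exponent vectors, written additively.
\<close>

datatype var = X int | Y int

type_synonym monom = "var \<Rightarrow>\<^sub>0 nat"
type_synonym 'k mpoly = "monom \<Rightarrow>\<^sub>0 'k"

definition monoms :: "var set \<Rightarrow> monom set" where
  "monoms V = {m. Poly_Mapping.keys m \<subseteq> V}"

definition poly_ring :: "var set \<Rightarrow> 'k::field mpoly ring" where
  "poly_ring V =
     \<lparr>carrier = {p. Poly_Mapping.keys p \<subseteq> monoms V}, mult = (*), one = 1, zero = 0, add = (+)\<rparr>"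

definition monom_poly :: "monom \<Rightarrow> 'k::field mpoly" where
  "monom_poly m = Poly_Mapping.single m 1"


subsection \<open>Monomial orders and Groebner bases\<close>

definition monomial_order :: "var set \<Rightarrow> (monom \<Rightarrow> monom \<Rightarrow> bool) \<Rightarrow> bool" where
  "monomial_order V lt \<longleftrightarrow>
     irreflp_on (monoms V) lt \<and> transp_on (monoms V) lt \<and> totalp_on (monoms V) lt \<and>
     (\<forall>m\<in>monoms V. m \<noteq> 0 \<longrightarrow> lt 0 m) \<and>
     (\<forall>u\<in>monoms V. \<forall>v\<in>monoms V. \<forall>w\<in>monoms V. lt u v \<longrightarrow> lt (u + w) (v + w))"

definition total_deg :: "monom \<Rightarrow> nat" where
  "total_deg m = (\<Sum>t\<in>Poly_Mapping.keys m. Poly_Mapping.lookup m t)"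

text \<open>The graded reverse lexicographic order with \<open>z 1 > z 2 > \<dots> > z n\<close>.\<close>

definition revlex :: "int \<Rightarrow> (int \<Rightarrow> var) \<Rightarrow> monom \<Rightarrow> monom \<Rightarrow> bool" where
  "revlex n z v v' \<longleftrightarrow>
     total_deg v < total_deg v' \<or>
     total_deg v = total_deg v' \<and>
       (\<exists>i\<in>{1..n}. Poly_Mapping.lookup v (z i) > Poly_Mapping.lookup v' (z i) \<and>
          (\<forall>l\<in>{i<..n}. Poly_Mapping.lookup v (z l) = Poly_Mapping.lookup v' (z l)))"

text \<open>The monomials in \<open>V\<close> are compared first, by \<open>lt1\<close>; ties are broken by \<open>lt2\<close> on those in \<open>U\<close>.\<close>

definition product_order ::
  "var set \<Rightarrow> (monom \<Rightarrow> monom \<Rightarrow> bool) \<Rightarrow> var set \<Rightarrow> (monom \<Rightarrow> monom \<Rightarrow> bool) \<Rightarrow>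
   monom \<Rightarrow> monom \<Rightarrow> bool" where
  "product_order V lt1 U lt2 m m' \<longleftrightarrow>
     (\<exists>u\<in>monoms U. \<exists>u'\<in>monoms U. \<exists>v\<in>monoms V. \<exists>v'\<in>monoms V.
        m = u + v \<and> m' = u' + v' \<and> (lt1 v v' \<or> v = v' \<and> lt2 u u'))"

definition lead_monom :: "(monom \<Rightarrow> monom \<Rightarrow> bool) \<Rightarrow> 'k::field mpoly \<Rightarrow> monom" where
  "lead_monom lt p =
     (THE m. m \<in> Poly_Mapping.keys p \<and> (\<forall>m'\<in>Poly_Mapping.keys p. m' \<noteq> m \<longrightarrow> lt m' m))"

definition initial_ideal ::
  "var set \<Rightarrow> (monom \<Rightarrow> monom \<Rightarrow> bool) \<Rightarrow> 'k::field mpoly set \<Rightarrow> 'k mpoly set" where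
  "initial_ideal V lt F =
     genideal (poly_ring V) {monom_poly (lead_monom lt p) | p. p \<in> F \<and> p \<noteq> 0}"

definition groebner_basis ::
  "var set \<Rightarrow> (monom \<Rightarrow> monom \<Rightarrow> bool) \<Rightarrow> 'k::field mpoly set \<Rightarrow> 'k mpoly set \<Rightarrow> bool" where
  "groebner_basis V lt G I \<longleftrightarrow>
     finite G \<and> G \<subseteq> I \<and> 0 \<notin> G \<and> initial_ideal V lt G = initial_ideal V lt I"


subsection \<open>The symmetric algebra of the path ideal of the cycle\<close>

text \<open>Indices are residues modulo \<open>n\<close>, represented by \<open>0, \<dots>, n - 1\<close>; so \<open>n\<close> and \<open>0\<close> name the
  same variable.\<close>

definition xvars :: "int \<Rightarrow> var set" where
  "xvars n = X ` {0..<n}"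

definition yvars :: "int \<Rightarrow> var set" where
  "yvars n = Y ` {0..<n}"

definition x_var :: "int \<Rightarrow> int \<Rightarrow> 'k::field mpoly" where
  "x_var n i = monom_poly (Poly_Mapping.single (X (i mod n)) 1)"

definition y_var :: "int \<Rightarrow> int \<Rightarrow> 'k::field mpoly" where
  "y_var n i = monom_poly (Poly_Mapping.single (Y (i mod n)) 1)"

abbreviation S_ring :: "int \<Rightarrow> 'k::field mpoly ring" where
  "S_ring n \<equiv> poly_ring (xvars n)"

abbreviation Ky_ring :: "int \<Rightarrow> 'k::field mpoly ring" where
  "Ky_ring n \<equiv> poly_ring (yvars n)"

abbreviation T_ring :: "int \<Rightarrow> 'k::field mpoly ring" where
  "T_ring n \<equiv> poly_ring (xvars n \<union> yvars n)"

text \<open>The generators \<open>u\<^sub>j\<close> of the path ideal \<open>I\<^bsub>n-2\<^esub>(C\<^sub>n)\<close>.\<close>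

definition path_monom :: "int \<Rightarrow> int \<Rightarrow> 'k::field mpoly" where
  "path_monom n j = (\<Prod>i\<in>{j..j + n - 3}. x_var n i)"

text \<open>
  The kernel of \<open>T \<rightarrow> Sym(I\<^bsub>n-2\<^esub>(C\<^sub>n))\<close>, \<open>y\<^sub>j \<mapsto> u\<^sub>j\<close>: it is generated by the linear forms given by the
  \<open>S\<close>-linear relations among the generators \<open>u\<^sub>j\<close>.
\<close>

definition sym_ideal :: "int \<Rightarrow> 'k::field mpoly set" where
  "sym_ideal n = genideal (T_ring n)
     {(\<Sum>i\<in>{1..n}. a i * y_var n i) | a.
        (\<forall>i\<in>{1..n}. a i \<in> carrier (S_ring n)) \<and> (\<Sum>i\<in>{1..n}. a i * path_monom n i) = 0}"

definition f_poly :: "int \<Rightarrow> int \<Rightarrow> 'k::field mpoly" where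
  "f_poly n j = x_var n (j - 2) * y_var n j - x_var n j * y_var n (j + 1)"

definition g_poly :: "int \<Rightarrow> int \<Rightarrow> 'k::field mpoly" where
  "g_poly n k = x_var n (2 * k - 2) * (\<Prod>i\<in>{i\<in>{0..<2 * k}. odd i}. y_var n i)
         - x_var n (n - 2) * (\<Prod>i\<in>{i\<in>{0..<2 * k}. even i}. y_var n i)"

definition h_poly :: "int \<Rightarrow> 'k::field mpoly" where
  "h_poly n = (\<Prod>i\<in>{i\<in>{0..<n}. odd i}. y_var n i) - (\<Prod>i\<in>{i\<in>{0..<n}. even i}. y_var n i)"

definition H_ideal :: "int \<Rightarrow> 'k::field mpoly set" where
  "H_ideal n = genideal (Ky_ring n) {h_poly n}"

definition HT_ideal :: "int \<Rightarrow> 'k::field mpoly set" where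
  "HT_ideal n = genideal (T_ring n) (H_ideal n)"

end

theory Submission
  imports Defs
begin

text \<open>
  Consider the homomorphism \<open>\<phi> : T \<rightarrow> S[t]\<close> with \<open>x\<^sub>i \<mapsto> x\<^sub>i\<close> and \<open>y\<^sub>j \<mapsto> u\<^sub>j t\<close>. It sends monomials to
  monomials, and its kernel contains \<open>L\<close>, because \<open>\<Sum> a\<^sub>i y\<^sub>i\<close> is sent to \<open>t \<Sum> a\<^sub>i u\<^sub>i\<close>, and also \<open>h\<close>.
  So \<open>L + HT \<subseteq> ker \<phi>\<close>, while all \<open>f\<^sub>j\<close>, \<open>g\<^sub>k\<close> and \<open>h\<close> lie in \<open>L + HT\<close>; for the \<open>g\<^sub>k\<close> this is the recursion
  \<open>g\<^bsub>k+1\<^esub> = y\<^bsub>2k\<^esub> g\<^sub>k - y\<^sub>1 y\<^sub>3 \<cdots> y\<^bsub>2k-1\<^esub> f\<^bsub>2k\<^esub>\<close> of \<open>g_poly_step\<close>.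

  In a nonzero \<open>p \<in> ker \<phi>\<close> the terms with the same image cancel. Hence the leading monomial \<open>m\<close> of \<open>p\<close>
  has the same image as another monomial \<open>m' < m\<close> of \<open>p\<close>. It therefore suffices that every monomial
  \<open>m\<close> which is not the smallest in its fibre under \<open>\<phi>\<close> is divisible by one of the leading monomials
  \<open>x\<^bsub>j-2\<^esub> y\<^sub>j\<close> of \<open>f\<^sub>j\<close>, \<open>x\<^bsub>2k-2\<^esub> y\<^sub>1 y\<^sub>3 \<cdots> y\<^bsub>2k-1\<^esub>\<close> of \<open>g\<^sub>k\<close>, or \<open>y\<^sub>1 y\<^sub>3 \<cdots> y\<^bsub>n-1\<^esub>\<close> of \<open>h\<close>. This reduction is
  \<open>groebner_basis_in_toric_ideal\<close>.

  Let \<open>m = x\<^sup>a y\<^sup>b\<close>, \<open>m' = x\<^sup>a' y\<^sup>b'\<close> and \<open>c = b' - b\<close>. As \<open>u\<^sub>j\<close> is the product of all variables except \<open>x\<^bsub>j-2\<^esub>\<close>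
  and \<open>x\<^bsub>j-1\<^esub>\<close>, the images agree iff the entries of \<open>c\<close> sum to zero and
  \<open>a\<^sub>i = a'\<^sub>i - (c\<^bsub>i+1\<^esub> + c\<^bsub>i+2\<^esub>)\<close> for all \<open>i\<close>. So \<open>y\<^sub>j\<close> divides \<open>m\<close> if \<open>c\<^sub>j < 0\<close>, and \<open>x\<^sub>i\<close> divides \<open>m\<close> if
  \<open>c\<^bsub>i+1\<^esub> + c\<^bsub>i+2\<^esub> < 0\<close>. The order says that the last nonzero entry among \<open>c\<^sub>1, \<dots>, c\<^sub>n\<close> is positive. What
  remains is a statement about the cyclic integer vector \<open>c\<close>, \<open>revlex_descent_dichotomy\<close>: if no
  \<open>f\<^sub>j\<close> applies, then \<open>c\<close> splits into adjacent pairs \<open>(d, -d)\<close>, one of which sits at the positions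
  \<open>(n, 1)\<close>, and following the negative entries \<open>c\<^sub>1, c\<^sub>3, \<dots>\<close> leads to a \<open>g\<^sub>k\<close> or to \<open>h\<close>.
\<close>

section \<open>Polynomial rings and their ideals\<close>

lemma monoms_0 [simp]: "0 \<in> monoms V"
  by (simp add: monoms_def)

lemma monoms_add [intro]: "a \<in> monoms V \<Longrightarrow> b \<in> monoms V \<Longrightarrow> a + b \<in> monoms V"
  using keys_add[of a b] by (auto simp: monoms_def)

lemma monoms_add_iff: "a + b \<in> monoms V \<longleftrightarrow> a \<in> monoms V \<and> b \<in> monoms V"
proof -
  have "Poly_Mapping.keys (a + b) = Poly_Mapping.keys a \<union> Poly_Mapping.keys b"
    by (auto simp: in_keys_iff lookup_add)
  then show ?thesis
    by (auto simp: monoms_def)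
qed

lemma monoms_sum: "(\<And>i. i \<in> A \<Longrightarrow> f i \<in> monoms V) \<Longrightarrow> sum f A \<in> monoms V"
  by (induction A rule: infinite_finite_induct) (auto intro: monoms_add)

lemma monoms_single: "v \<in> V \<Longrightarrow> Poly_Mapping.single v k \<in> monoms V"
  by (auto simp: monoms_def)

lemma monoms_mono: "V \<subseteq> W \<Longrightarrow> monoms V \<subseteq> monoms W"
  by (auto simp: monoms_def)

lemma poly_ring_sel [simp]:
  "mult (poly_ring V) = (*)" "one (poly_ring V) = 1" "zero (poly_ring V) = 0"
  "add (poly_ring V) = (+)"
  by (simp_all add: poly_ring_def)

lemma carrier_poly_ring: "p \<in> carrier (poly_ring V) \<longleftrightarrow> Poly_Mapping.keys p \<subseteq> monoms V"
  by (simp add: poly_ring_def)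

lemma poly_ring_zero_closed [simp]: "0 \<in> carrier (poly_ring V)"
  by (simp add: carrier_poly_ring)

lemma poly_ring_one_closed [simp]: "1 \<in> carrier (poly_ring V)"
  by (simp add: carrier_poly_ring)

lemma poly_ring_add_closed:
  "p \<in> carrier (poly_ring V) \<Longrightarrow> q \<in> carrier (poly_ring V) \<Longrightarrow> p + q \<in> carrier (poly_ring V)"
  unfolding carrier_poly_ring using keys_add[of p q] by blast

lemma poly_ring_mult_closed:
  assumes "p \<in> carrier (poly_ring V)" and "q \<in> carrier (poly_ring V)"
  shows "p * q \<in> carrier (poly_ring V)"
proof -
  have "{a + b | a b. a \<in> Poly_Mapping.keys p \<and> b \<in> Poly_Mapping.keys q} \<subseteq> monoms V"
    using assms unfolding carrier_poly_ring by (blast intro: monoms_add)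
  then show ?thesis
    unfolding carrier_poly_ring using keys_mult[of p q] by (rule order_trans[rotated])
qed

lemma poly_ring_uminus_closed:
  "p \<in> carrier (poly_ring V) \<Longrightarrow> - p \<in> carrier (poly_ring V)"
  by (simp add: carrier_poly_ring)

lemmas poly_ring_closed = poly_ring_add_closed poly_ring_mult_closed poly_ring_uminus_closed

lemma poly_ring_diff_closed:
  assumes "p \<in> carrier (poly_ring V)" "q \<in> carrier (poly_ring V)"
  shows "p - q \<in> carrier (poly_ring V)"
  using poly_ring_add_closed[OF assms(1) poly_ring_uminus_closed[OF assms(2)]] by simp

lemma poly_ring_sum_closed:
  "(\<And>i. i \<in> A \<Longrightarrow> p i \<in> carrier (poly_ring V)) \<Longrightarrow> sum p A \<in> carrier (poly_ring V)"
  by (induction A rule: infinite_finite_induct) (auto intro: poly_ring_closed)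

lemma monom_poly_closed: "monom_poly m \<in> carrier (poly_ring V) \<longleftrightarrow> m \<in> monoms V"
  by (simp add: carrier_poly_ring monom_poly_def)

lemma poly_ring_mono: "V \<subseteq> W \<Longrightarrow> carrier (poly_ring V) \<subseteq> carrier (poly_ring W)"
  using monoms_mono[of V W] by (auto simp: carrier_poly_ring)

lemma cring_poly_ring: "cring (poly_ring V :: 'k::field mpoly ring)"
proof (rule cringI)
  show "abelian_group (poly_ring V :: 'k mpoly ring)"
  proof (rule abelian_groupI)
    fix p :: "'k mpoly" assume "p \<in> carrier (poly_ring V)"
    then show "\<exists>q\<in>carrier (poly_ring V). q \<oplus>\<^bsub>poly_ring V\<^esub> p = \<zero>\<^bsub>poly_ring V\<^esub>"
      by (intro bexI[of _ "- p"]) (auto intro: poly_ring_closed)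
  qed (auto intro: poly_ring_closed)
  show "Group.comm_monoid (poly_ring V :: 'k mpoly ring)"
    by (rule comm_monoidI) (auto intro: poly_ring_closed simp: mult.assoc mult.commute)
qed (simp add: distrib_right)

lemma ring_poly_ring: "ring (poly_ring V)"
  using cring_poly_ring cring_def by blast

lemma poly_ring_idealI:
  assumes "I \<subseteq> carrier (poly_ring V)" and "0 \<in> I"
    and "\<And>p q. p \<in> I \<Longrightarrow> q \<in> I \<Longrightarrow> p + q \<in> I"
    and mult: "\<And>r p. r \<in> carrier (poly_ring V) \<Longrightarrow> p \<in> I \<Longrightarrow> r * p \<in> I"
  shows "ideal I (poly_ring V :: 'k::field mpoly ring)"
proof (rule idealI[OF ring_poly_ring])
  interpret cring "poly_ring V :: 'k mpoly ring"
    by (rule cring_poly_ring)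
  show "subgroup I (add_monoid (poly_ring V :: 'k mpoly ring))"
  proof (rule add.subgroupI)
    fix p assume "p \<in> I"
    then have p: "p \<in> carrier (poly_ring V)"
      using assms(1) by blast
    have "\<ominus>\<^bsub>poly_ring V\<^esub> p = - p"
      using minus_equality[of "- p" p] p poly_ring_uminus_closed[OF p] by simp
    then show "\<ominus>\<^bsub>poly_ring V\<^esub> p \<in> I"
      using mult[of "-1" p] \<open>p \<in> I\<close> by (simp add: poly_ring_closed)
  qed (use assms in auto)
  show "p \<otimes>\<^bsub>poly_ring V\<^esub> r \<in> I" "r \<otimes>\<^bsub>poly_ring V\<^esub> p \<in> I"
    if "p \<in> I" "r \<in> carrier (poly_ring V)" for p r
    using mult[OF that(2,1)] by (simp_all add: mult.commute)
qed

lemma ideal_poly_ring_closed: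
  assumes "ideal I (poly_ring V)"
  shows "I \<subseteq> carrier (poly_ring V)" and "0 \<in> I"
    and "p \<in> I \<Longrightarrow> q \<in> I \<Longrightarrow> p + q \<in> I"
    and "r \<in> carrier (poly_ring V) \<Longrightarrow> p \<in> I \<Longrightarrow> r * p \<in> I"
proof -
  interpret ideal I "poly_ring V"
    by fact
  show "I \<subseteq> carrier (poly_ring V)"
    by (rule a_subset)
  show "0 \<in> I"
    using additive_subgroup.zero_closed[OF is_additive_subgroup] by simp
  show "p + q \<in> I" if "p \<in> I" "q \<in> I"
    using additive_subgroup.a_closed[OF is_additive_subgroup that] by simp
  show "r * p \<in> I" if "r \<in> carrier (poly_ring V)" "p \<in> I"
    using I_l_closed[OF that(2,1)] by simp
qed

lemma ideal_poly_ring_diff: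
  assumes "ideal I (poly_ring V)" and "p \<in> I" and "q \<in> I"
  shows "p - q \<in> I"
  using ideal_poly_ring_closed(3)[OF assms(1,2), of "- q"]
    ideal_poly_ring_closed(4)[OF assms(1), of "-1" q] assms(3)
  by (simp add: poly_ring_closed)

lemma monom_poly_add: "monom_poly (a + b) = monom_poly a * monom_poly b"
  by (simp add: monom_poly_def mult_single)

lemma monom_poly_0: "monom_poly 0 = 1"
  unfolding monom_poly_def by (rule single_one)

lemma monom_poly_sum: "monom_poly (sum f A) = (\<Prod>i\<in>A. monom_poly (f i))"
  by (induction A rule: infinite_finite_induct) (simp_all add: monom_poly_0 monom_poly_add)

lemma monom_poly_inject: "(monom_poly a :: 'k::field mpoly) = monom_poly b \<longleftrightarrow> a = b"
proof
  assume "monom_poly a = (monom_poly b :: 'k mpoly)"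
  then have "Poly_Mapping.keys (monom_poly a :: 'k mpoly) = Poly_Mapping.keys (monom_poly b :: 'k mpoly)"
    by (rule arg_cong)
  then show "a = b"
    by (simp add: monom_poly_def)
qed simp

lemma keys_binomial: "Poly_Mapping.keys (monom_poly a - monom_poly b :: 'k::field mpoly) \<subseteq> {a, b}"
  using keys_diff[of "monom_poly a :: 'k mpoly" "monom_poly b"] by (auto simp: monom_poly_def)

section \<open>Groebner bases of ideals contained in a toric ideal\<close>

lemma leading_monomial:
  fixes p :: "'k::field mpoly"
  assumes irrefl: "irreflp_on (monoms V) lt" and trans: "transp_on (monoms V) lt"
    and total: "totalp_on (monoms V) lt"
    and p: "p \<in> carrier (poly_ring V)" "p \<noteq> 0"
  shows "lead_monom lt p \<in> Poly_Mapping.keys p"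
    and "\<And>m. m \<in> Poly_Mapping.keys p \<Longrightarrow> m \<noteq> lead_monom lt p \<Longrightarrow> lt m (lead_monom lt p)"
proof -
  let ?K = "Poly_Mapping.keys p"
  have K: "?K \<subseteq> monoms V"
    using p by (simp add: carrier_poly_ring)
  have asym: "asymp_on (monoms V) lt"
    using irrefl trans asymp_on_iff_irreflp_on_if_transp_on by blast
  obtain m where m: "m \<in> ?K" "\<forall>x\<in>?K. x \<noteq> m \<longrightarrow> \<not> lt m x"
    using Finite_Set.bex_max_element[of ?K lt] asymp_on_subset[OF asym K]
      transp_on_subset[OF trans K] p(2) by auto
  have max: "lt x m" if "x \<in> ?K" "x \<noteq> m" for x
    using totalp_onD[OF total subsetD[OF K that(1)] subsetD[OF K m(1)] that(2)] m(2) that by blast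
  have "lead_monom lt p = m"
    unfolding lead_monom_def
  proof (rule the_equality)
    fix x assume x: "x \<in> ?K \<and> (\<forall>m'\<in>?K. m' \<noteq> x \<longrightarrow> lt m' x)"
    show "x = m"
    proof (rule ccontr)
      assume "x \<noteq> m"
      then show False
        using x m max[of x] by metis
    qed
  qed (use m max in auto)
  then show "lead_monom lt p \<in> ?K" "\<And>m. m \<in> ?K \<Longrightarrow> m \<noteq> lead_monom lt p \<Longrightarrow> lt m (lead_monom lt p)"
    using m max by auto
qed

lemma binomial_nonzero:
  assumes "irreflp_on (monoms V) lt" and "a \<in> monoms V" and "lt b a"
  shows "monom_poly a - monom_poly b \<noteq> (0 :: 'k::field mpoly)"
  using assms monom_poly_inject[of a b] by (auto simp: irreflp_on_def)

lemma lead_monom_binomial: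
  assumes order: "irreflp_on (monoms V) lt" "transp_on (monoms V) lt" "totalp_on (monoms V) lt"
    and ab: "a \<in> monoms V" "b \<in> monoms V" "lt b a"
  shows "lead_monom lt (monom_poly a - monom_poly b :: 'k::field mpoly) = a"
proof -
  let ?p = "monom_poly a - monom_poly b :: 'k mpoly"
  have "?p \<in> carrier (poly_ring V)"
    using ab by (intro poly_ring_diff_closed) (simp_all add: monom_poly_closed)
  note lead = leading_monomial[OF order this binomial_nonzero[OF order(1) ab(1,3)]]
  have ne: "a \<noteq> b"
    using ab order(1) by (auto simp: irreflp_on_def)
  then have "a \<in> Poly_Mapping.keys ?p"
    by (simp add: in_keys_iff lookup_minus monom_poly_def lookup_single when_def)
  moreover have "\<not> lt a b"
    using ab order by (meson irreflp_onD transp_onD)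
  ultimately show ?thesis
    using lead keys_binomial[of a b] by (metis insertE singletonD subsetD)
qed

text \<open>The linear extension of \<open>w\<close> from monomials to polynomials.\<close>

definition push_forward :: "(monom \<Rightarrow> monom) \<Rightarrow> 'k::field mpoly \<Rightarrow> 'k mpoly" where
  "push_forward w p = (\<Sum>m\<in>Poly_Mapping.keys p. Poly_Mapping.single (w m) (Poly_Mapping.lookup p m))"

lemma push_forward_0 [simp]: "push_forward w 0 = 0"
  by (simp add: push_forward_def)

lemma push_forward_add: "push_forward w (p + q) = push_forward w p + push_forward w q"
  unfolding push_forward_def by (rule setsum_keys_plus_distrib) (auto simp: single_add)

lemma push_forward_sum: "push_forward w (sum p A) = (\<Sum>i\<in>A. push_forward w (p i))"
  by (induction A rule: infinite_finite_induct) (simp_all add: push_forward_add)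

lemma push_forward_diff: "push_forward w (p - q) = push_forward w p - push_forward w q"
  using push_forward_add[of w "p - q" q] by (simp add: algebra_simps)

lemma push_forward_single: "push_forward w (Poly_Mapping.single m c) = Poly_Mapping.single (w m) c"
  by (cases "c = 0") (simp_all add: push_forward_def)

lemma push_forward_monom_poly: "push_forward w (monom_poly m) = monom_poly (w m)"
  by (simp add: monom_poly_def push_forward_single)

lemma poly_mapping_eq_sum_single:
  "p = (\<Sum>m\<in>Poly_Mapping.keys p. Poly_Mapping.single m (Poly_Mapping.lookup p m))"
  by (rule poly_mapping_eqI) (auto simp: lookup_sum lookup_single when_def in_keys_iff)

lemma push_forward_fixed:
  assumes "\<And>m. m \<in> Poly_Mapping.keys p \<Longrightarrow> w m = m"
  shows "push_forward w p = p"
proof -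
  have "push_forward w p =
      (\<Sum>m\<in>Poly_Mapping.keys p. Poly_Mapping.single m (Poly_Mapping.lookup p m))"
    unfolding push_forward_def using assms by (intro sum.cong) auto
  then show ?thesis
    by (simp flip: poly_mapping_eq_sum_single)
qed

text \<open>
  By bilinearity it is enough to compare the two sides on products of two terms.
\<close>

lemma push_forward_mult:
  assumes "\<And>a b. w (a + b) = w a + w b"
  shows "push_forward w (p * q) = push_forward w p * push_forward w q"
proof -
  have "push_forward w (p * q) = push_forward w
    ((\<Sum>m\<in>Poly_Mapping.keys p. Poly_Mapping.single m (Poly_Mapping.lookup p m)) *
     (\<Sum>m\<in>Poly_Mapping.keys q. Poly_Mapping.single m (Poly_Mapping.lookup q m)))"
    by (simp flip: poly_mapping_eq_sum_single)
  also have "\<dots> = push_forward w p * push_forward w q"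
    by (simp add: sum_product push_forward_sum push_forward_single mult_single assms
        push_forward_def[of w p] push_forward_def[of w q])
  finally show ?thesis .
qed

text \<open>
  For additive \<open>w\<close> the map \<open>push_forward w\<close> is a ring homomorphism, and this is its kernel on \<open>K[V]\<close>.
\<close>

definition toric_ideal :: "var set \<Rightarrow> (monom \<Rightarrow> monom) \<Rightarrow> 'k::field mpoly set" where
  "toric_ideal V w = {p \<in> carrier (poly_ring V). push_forward w p = 0}"

lemma ideal_toric_ideal:
  assumes "\<And>a b. w (a + b) = w a + w b"
  shows "ideal (toric_ideal V w) (poly_ring V)"
  by (rule poly_ring_idealI)
    (auto simp: toric_ideal_def push_forward_add push_forward_mult[of w, OF assms]
      intro: poly_ring_add_closed poly_ring_mult_closed)

text \<open>The terms of a fibre of \<open>w\<close> cancel, so none of them is alone in its fibre.\<close>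

lemma toric_ideal_fibre:
  assumes "push_forward w p = 0" and m: "m \<in> Poly_Mapping.keys p"
  obtains m' where "m' \<in> Poly_Mapping.keys p" and "m' \<noteq> m" and "w m' = w m"
proof -
  have "\<exists>m'\<in>Poly_Mapping.keys p. m' \<noteq> m \<and> w m' = w m"
  proof (rule ccontr)
    assume none: "\<not> ?thesis"
    have "0 = Poly_Mapping.lookup (push_forward w p) (w m)"
      using assms by simp
    also have "\<dots> = (\<Sum>x\<in>Poly_Mapping.keys p. if x = m then Poly_Mapping.lookup p x else 0)"
      unfolding push_forward_def lookup_sum
      using none by (intro sum.cong) (auto simp: lookup_single when_def)
    also have "\<dots> = Poly_Mapping.lookup p m"
      using m by simp
    finally show False
      using m by (simp add: in_keys_iff)
  qed
  with that show ?thesis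
    by blast
qed

text \<open>
  The leading monomial of a nonzero \<open>p \<in> I\<close> shares its value of \<open>w\<close> with another monomial of \<open>p\<close>,
  and that one is smaller. So it suffices that every monomial that is not minimal in its fibre
  of \<open>w\<close> is divisible by a leading monomial of \<open>G\<close>.
\<close>

lemma groebner_basis_in_toric_ideal:
  fixes G I :: "'k::field mpoly set"
  assumes order: "irreflp_on (monoms V) lt" "transp_on (monoms V) lt" "totalp_on (monoms V) lt"
    and G: "finite G" "G \<subseteq> I" "0 \<notin> G" and I: "I \<subseteq> toric_ideal V w"
    and divisor: "\<And>m m'. \<lbrakk>m \<in> monoms V; m' \<in> monoms V; m' \<noteq> m; w m' = w m; lt m' m\<rbrakk> \<Longrightarrow>
      \<exists>g\<in>G. \<exists>d. m = d + lead_monom lt g"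
  shows "groebner_basis V lt G I"
proof -
  interpret ring "poly_ring V :: 'k mpoly ring"
    by (rule ring_poly_ring)
  let ?LG = "{monom_poly (lead_monom lt p) | p. p \<in> G \<and> p \<noteq> 0} :: 'k mpoly set"
  let ?LI = "{monom_poly (lead_monom lt p) | p. p \<in> I \<and> p \<noteq> 0} :: 'k mpoly set"
  have lead: "lead_monom lt p \<in> Poly_Mapping.keys p"
    "\<And>m. m \<in> Poly_Mapping.keys p \<Longrightarrow> m \<noteq> lead_monom lt p \<Longrightarrow> lt m (lead_monom lt p)"
    "Poly_Mapping.keys p \<subseteq> monoms V"
    if "p \<in> I" "p \<noteq> 0" for p
  proof -
    have p: "p \<in> carrier (poly_ring V)"
      using that I by (auto simp: toric_ideal_def)
    then show "lead_monom lt p \<in> Poly_Mapping.keys p"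
      "\<And>m. m \<in> Poly_Mapping.keys p \<Longrightarrow> m \<noteq> lead_monom lt p \<Longrightarrow> lt m (lead_monom lt p)"
      "Poly_Mapping.keys p \<subseteq> monoms V"
      using leading_monomial[OF order p that(2)] by (auto simp: carrier_poly_ring)
  qed
  have sub: "?LG \<subseteq> ?LI"
    using G by blast
  have carr: "?LI \<subseteq> carrier (poly_ring V)"
    using lead(1,3) by (fastforce simp: monom_poly_closed)
  have "?LI \<subseteq> genideal (poly_ring V) ?LG"
  proof
    fix q assume "q \<in> ?LI"
    then obtain p where p: "p \<in> I" "p \<noteq> 0" and q: "q = monom_poly (lead_monom lt p)"
      by blast
    let ?m = "lead_monom lt p"
    have "push_forward w p = 0"
      using p I by (auto simp: toric_ideal_def)
    then obtain m' where m': "m' \<in> Poly_Mapping.keys p" "m' \<noteq> ?m" "w m' = w ?m"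
      using toric_ideal_fibre lead(1)[OF p] by blast
    then obtain g d where g: "g \<in> G" and d: "?m = d + lead_monom lt g"
      using divisor[of ?m m'] lead[OF p] by blast
    have "d \<in> monoms V"
      using lead[OF p] d monoms_add_iff by (metis subsetD)
    moreover have "monom_poly (lead_monom lt g) \<in> genideal (poly_ring V) ?LG"
      using genideal_self[of ?LG] sub carr g G(3) by blast
    ultimately show "q \<in> genideal (poly_ring V) ?LG"
      using ideal_poly_ring_closed(4)[OF genideal_ideal[of ?LG]] sub carr
      by (simp add: q d monom_poly_add monom_poly_closed)
  qed
  then have "genideal (poly_ring V) ?LI \<subseteq> genideal (poly_ring V) ?LG"
    using genideal_minimal[OF genideal_ideal[of ?LG]] sub carr by blast
  moreover have "genideal (poly_ring V) ?LG \<subseteq> genideal (poly_ring V) ?LI"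
    by (rule subset_Idl_subset[OF carr sub])
  ultimately show ?thesis
    using G by (auto simp: groebner_basis_def initial_ideal_def)
qed

section \<open>Product orders\<close>

text \<open>
  \<open>product_order\<close> quantifies over factorisations into a \<open>U\<close>-part and a \<open>V\<close>-part. Existence and
  uniqueness of this factorisation make it a comparison of the two parts, from which the order
  axioms are read off componentwise.
\<close>

lemma monoms_disjoint_decomposition_unique:
  assumes "U \<inter> V = {}" and "u \<in> monoms U" "u' \<in> monoms U" "v \<in> monoms V" "v' \<in> monoms V"
    and eq: "u + v = u' + v'"
  shows "u = u'" and "v = v'"
proof -
  have *: "Poly_Mapping.lookup u t = Poly_Mapping.lookup u' t \<and>
      Poly_Mapping.lookup v t = Poly_Mapping.lookup v' t" for t
  proof -
    have "Poly_Mapping.lookup u t + Poly_Mapping.lookup v t =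
        Poly_Mapping.lookup u' t + Poly_Mapping.lookup v' t"
      using eq by (metis lookup_add)
    moreover have "t \<notin> U \<Longrightarrow> Poly_Mapping.lookup u t = 0 \<and> Poly_Mapping.lookup u' t = 0"
      and "t \<notin> V \<Longrightarrow> Poly_Mapping.lookup v t = 0 \<and> Poly_Mapping.lookup v' t = 0"
      using assms(2-5) by (auto simp: monoms_def in_keys_iff subset_iff)
    ultimately show ?thesis
      using assms(1) by (cases "t \<in> U"; cases "t \<in> V") auto
  qed
  show "u = u'" "v = v'"
    by (rule poly_mapping_eqI; simp add: *)+
qed

lemma monoms_Un_decomposition:
  assumes "m \<in> monoms (U \<union> V)"
  obtains u v where "u \<in> monoms U" and "v \<in> monoms V" and "m = u + v"
proof -
  let ?part = "\<lambda>S. \<Sum>t\<in>Poly_Mapping.keys m \<inter> S. Poly_Mapping.single t (Poly_Mapping.lookup m t)"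
  have part: "Poly_Mapping.lookup (?part S) t = (if t \<in> S then Poly_Mapping.lookup m t else 0)" for S t
    by (auto simp: lookup_sum lookup_single when_def in_keys_iff)
  have "?part U \<in> monoms U" "?part (V - U) \<in> monoms V"
    unfolding monoms_def by (auto simp: in_keys_iff part split: if_splits)
  moreover have "m = ?part U + ?part (V - U)"
    using assms by (intro poly_mapping_eqI) (auto simp: lookup_add part monoms_def in_keys_iff)
  ultimately show ?thesis
    using that by blast
qed

lemma product_order_strict_linear:
  assumes disj: "U \<inter> V = {}"
    and 1: "irreflp_on (monoms V) lt1" "transp_on (monoms V) lt1" "totalp_on (monoms V) lt1"
    and 2: "irreflp_on (monoms U) lt2" "transp_on (monoms U) lt2" "totalp_on (monoms U) lt2"
  shows "irreflp_on (monoms (U \<union> V)) (product_order V lt1 U lt2)"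
    and "transp_on (monoms (U \<union> V)) (product_order V lt1 U lt2)"
    and "totalp_on (monoms (U \<union> V)) (product_order V lt1 U lt2)"
proof -
  have iff: "product_order V lt1 U lt2 (u + v) (u' + v') \<longleftrightarrow> lt1 v v' \<or> v = v' \<and> lt2 u u'"
    if "u \<in> monoms U" "u' \<in> monoms U" "v \<in> monoms V" "v' \<in> monoms V" for u u' v v'
    using that monoms_disjoint_decomposition_unique[OF disj] unfolding product_order_def by metis
  show "irreflp_on (monoms (U \<union> V)) (product_order V lt1 U lt2)"
  proof (rule irreflp_onI)
    fix m assume "m \<in> monoms (U \<union> V)"
    then show "\<not> product_order V lt1 U lt2 m m"
      by (metis monoms_Un_decomposition iff 1(1) 2(1) irreflp_onD)
  qed
  show "totalp_on (monoms (U \<union> V)) (product_order V lt1 U lt2)"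
  proof (rule totalp_onI)
    fix m m' assume m: "m \<in> monoms (U \<union> V)" "m' \<in> monoms (U \<union> V)" "m \<noteq> m'"
    obtain u v where uv: "u \<in> monoms U" "v \<in> monoms V" "m = u + v"
      using m monoms_Un_decomposition by blast
    obtain u' v' where uv': "u' \<in> monoms U" "v' \<in> monoms V" "m' = u' + v'"
      using m monoms_Un_decomposition by blast
    show "product_order V lt1 U lt2 m m' \<or> product_order V lt1 U lt2 m' m"
      using iff uv uv' m(3) 1(3) 2(3) by (metis totalp_onD)
  qed
  show "transp_on (monoms (U \<union> V)) (product_order V lt1 U lt2)"
  proof (rule transp_onI)
    fix l m r assume m: "l \<in> monoms (U \<union> V)" "m \<in> monoms (U \<union> V)" "r \<in> monoms (U \<union> V)"
      and lt: "product_order V lt1 U lt2 l m" "product_order V lt1 U lt2 m r"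
    obtain u v where uv: "u \<in> monoms U" "v \<in> monoms V" "l = u + v"
      using m monoms_Un_decomposition by blast
    obtain u' v' where uv': "u' \<in> monoms U" "v' \<in> monoms V" "m = u' + v'"
      using m monoms_Un_decomposition by blast
    obtain u'' v'' where uv'': "u'' \<in> monoms U" "v'' \<in> monoms V" "r = u'' + v''"
      using m monoms_Un_decomposition by blast
    have "lt1 v v' \<or> v = v' \<and> lt2 u u'" "lt1 v' v'' \<or> v' = v'' \<and> lt2 u' u''"
      using lt iff uv uv' uv'' by auto
    then have "lt1 v v'' \<or> v = v'' \<and> lt2 u u''"
      using uv uv' uv'' 1(2) 2(2) by (meson transp_onD)
    then show "product_order V lt1 U lt2 l r"
      using iff uv uv'' by auto
  qed
qed

lemma revlex_strict_linear:
  shows "irreflp_on (monoms (z ` {1..n})) (revlex n z)"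
    and "transp_on (monoms (z ` {1..n})) (revlex n z)"
    and "totalp_on (monoms (z ` {1..n})) (revlex n z)"
proof -
  show "irreflp_on (monoms (z ` {1..n})) (revlex n z)"
    by (rule irreflp_onI) (simp add: revlex_def)
  show "totalp_on (monoms (z ` {1..n})) (revlex n z)"
  proof (rule totalp_onI)
    fix v v' assume v: "v \<in> monoms (z ` {1..n})" "v' \<in> monoms (z ` {1..n})" "v \<noteq> v'"
    let ?D = "{i \<in> {1..n}. Poly_Mapping.lookup v (z i) \<noteq> Poly_Mapping.lookup v' (z i)}"
    have "?D \<noteq> {}"
    proof
      assume D: "?D = {}"
      have "Poly_Mapping.lookup v t = Poly_Mapping.lookup v' t" for t
      proof (cases "t \<in> z ` {1..n}")
        case True
        then show ?thesis using D by auto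
      next
        case False
        then have "t \<notin> Poly_Mapping.keys v" "t \<notin> Poly_Mapping.keys v'"
          using v by (auto simp: monoms_def)
        then show ?thesis
          by (simp add: in_keys_iff)
      qed
      then show False
        using v(3) poly_mapping_eqI by blast
    qed
    moreover have "finite ?D"
      by (rule finite_subset[of _ "{1..n}"]) auto
    ultimately obtain i where i: "i \<in> ?D" "\<And>l. l \<in> ?D \<Longrightarrow> l \<le> i"
      using Max_in[of ?D] Max_ge[of ?D] by blast
    have "\<forall>l\<in>{i<..n}. Poly_Mapping.lookup v (z l) = Poly_Mapping.lookup v' (z l)"
    proof (rule ballI, rule ccontr)
      fix l assume "l \<in> {i<..n}" "Poly_Mapping.lookup v (z l) \<noteq> Poly_Mapping.lookup v' (z l)"
      then show False
        using i(1) i(2)[of l] by auto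
    qed
    with i(1) show "revlex n z v v' \<or> revlex n z v' v"
      unfolding revlex_def by (metis (mono_tags, lifting) mem_Collect_eq nat_neq_iff)
  qed
  show "transp_on (monoms (z ` {1..n})) (revlex n z)"
  proof (rule transp_onI)
    fix a b c assume lt: "revlex n z a b" "revlex n z b c"
    show "revlex n z a c"
    proof (cases "total_deg a = total_deg b \<and> total_deg b = total_deg c")
      case True
      then obtain i where i: "i \<in> {1..n}" "Poly_Mapping.lookup a (z i) > Poly_Mapping.lookup b (z i)"
        "\<forall>l\<in>{i<..n}. Poly_Mapping.lookup a (z l) = Poly_Mapping.lookup b (z l)"
        using lt unfolding revlex_def by auto
      obtain j where j: "j \<in> {1..n}" "Poly_Mapping.lookup b (z j) > Poly_Mapping.lookup c (z j)"
        "\<forall>l\<in>{j<..n}. Poly_Mapping.lookup b (z l) = Poly_Mapping.lookup c (z l)"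
        using True lt unfolding revlex_def by auto
      have "Poly_Mapping.lookup a (z (max i j)) > Poly_Mapping.lookup c (z (max i j))"
        using i j by (cases i j rule: linorder_cases) (auto simp: max_def)
      moreover have "\<forall>l\<in>{max i j<..n}. Poly_Mapping.lookup a (z l) = Poly_Mapping.lookup c (z l)"
        using i(3) j(3) by simp
      moreover have "max i j \<in> {1..n}"
        using i j by auto
      ultimately show ?thesis
        using True unfolding revlex_def by auto
    next
      case False
      then show ?thesis
        using lt unfolding revlex_def by auto
    qed
  qed
qed

section \<open>Cyclic integer vectors whose last nonzero entry is positive\<close>

text \<open>
  Here \<open>c = b' - b\<close>, where \<open>b\<close> and \<open>b'\<close> are the \<open>y\<close>-exponents of two monomials of one fibre of the
  toric map, the second being the smaller one; \<open>last\<close> is the reverse lexicographic comparison. If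
  \<open>no_f\<close> fails, then the leading monomial of some \<open>f\<^sub>j\<close> divides the larger monomial; the
  conclusion yields divisibility by that of \<open>g\<^sub>k\<close> or, when \<open>2 * k = n\<close>, of \<open>h\<close>.

  Since no \<open>f\<^sub>j\<close> applies, each negative entry is outweighed by the positive entry just before it.
  The entries sum to zero, so this is an exact matching: \<open>c\<close> consists of adjacent pairs \<open>(d, -d)\<close>
  and zeros. The last nonzero entry is positive, so its negative partner can only be reached by
  wrapping around from \<open>n\<close> to \<open>1\<close>, hence \<open>c 1 < 0\<close>. From there one walks up through the odd indices:
  either \<open>c (2 * k - 1) + c (2 * k) < 0\<close>, or \<open>c (2 * k)\<close> is positive and its partner \<open>c (2 * k + 1)\<close> is
  negative. If the walk never stops, all odd entries are negative.
\<close>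

lemma revlex_descent_dichotomy:
  fixes c :: "int \<Rightarrow> int" and n :: int
  assumes "even n" and "n \<ge> 2" and periodic: "c n = c 0" and sum: "(\<Sum>i\<in>{0..<n}. c i) = 0"
    and last: "i \<in> {1..n}" "c i > 0" "\<forall>l\<in>{i<..n}. c l = 0"
    and no_f: "\<not> (\<exists>j\<in>{1..n - 1}. c j < 0 \<and> c (j - 1) + c j < 0)"
  shows "\<exists>k\<in>{1..n div 2}. (\<forall>i\<in>{0..<2 * k}. odd i \<longrightarrow> c i < 0) \<and>
           (2 * k = n \<or> c (2 * k - 1) + c (2 * k) < 0)"
proof -
  let ?pos = "\<lambda>j. max (c j) 0" and ?neg = "\<lambda>j. max (- c j) 0"
  have c0: "c 0 \<ge> 0"
    using last periodic by (cases "i = n") auto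
  \<comment> \<open>The sum of \<open>?pos j - ?neg (j + 1)\<close> is that of \<open>c\<close>, shifted cyclically, so it is zero.\<close>
  have "(\<Sum>j\<in>{0..<n}. ?neg (j + 1)) = (\<Sum>j\<in>{1..n}. ?neg j)"
    by (rule sum.reindex_bij_witness[of _ "\<lambda>j. j - 1" "\<lambda>j. j + 1"]) auto
  also have "\<dots> = (\<Sum>j\<in>{0..<n}. ?neg j)"
  proof -
    have "{1..n} = insert n {1..<n}" "{0..<n} = insert 0 {1..<n}"
      using \<open>n \<ge> 2\<close> by auto
    then show ?thesis
      by (simp add: periodic)
  qed
  finally have "(\<Sum>j\<in>{0..<n}. ?pos j - ?neg (j + 1)) = (\<Sum>j\<in>{0..<n}. ?pos j - ?neg j)"
    by (simp add: sum_subtractf)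
  also have "\<dots> = (\<Sum>j\<in>{0..<n}. c j)"
    by (rule sum.cong) auto
  finally have total: "(\<Sum>j\<in>{0..<n}. ?pos j - ?neg (j + 1)) = 0"
    using sum by simp
  have nonneg: "?pos j - ?neg (j + 1) \<ge> 0" if j: "j \<in> {0..<n}" for j
  proof (cases "j + 1 = n")
    case True
    then show ?thesis using c0 periodic by simp
  next
    case False
    then have "j + 1 \<in> {1..n - 1}"
      using j by auto
    then have "\<not> (c (j + 1) < 0 \<and> c j + c (j + 1) < 0)"
      using no_f by (metis add_diff_cancel_right')
    then show ?thesis by auto
  qed
  have match: "?pos j = ?neg (j + 1)" if "j \<in> {0..<n}" for j
    using sum_nonneg_eq_0_iff[of "{0..<n}" "\<lambda>j. ?pos j - ?neg (j + 1)"] nonneg total that by force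
  have "i = n"
  proof (rule ccontr)
    assume "i \<noteq> n"
    then have "i \<in> {0..<n}" "c (i + 1) = 0"
      using last by auto
    then show False
      using match[of i] last(2) by simp
  qed
  then have "c 1 < 0"
    using match[of 0] last(2) periodic \<open>n \<ge> 2\<close> by (auto simp: max_def split: if_splits)
  show ?thesis
  proof (rule ccontr)
    assume none: "\<not> ?thesis"
    have "int k \<le> n div 2 \<Longrightarrow> \<forall>i\<in>{0..<2 * int k}. odd i \<longrightarrow> c i < 0" for k
    proof (induction k)
      case 0
      then show ?case by simp
    next
      case (Suc k)
      have "c (2 * int k + 1) < 0"
      proof (cases "k = 0")
        case True
        then show ?thesis using \<open>c 1 < 0\<close> by simp
      next
        case False
        let ?k = "int k"
        have k: "?k \<in> {1..n div 2}" "2 * ?k < n"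
          using False Suc.prems \<open>even n\<close> by auto
        have IH: "\<forall>i\<in>{0..<2 * ?k}. odd i \<longrightarrow> c i < 0"
          using Suc by simp
        then have "c (2 * ?k - 1) < 0"
          using k by simp
        moreover have "\<not> c (2 * ?k - 1) + c (2 * ?k) < 0"
          using none k IH by blast
        ultimately show ?thesis
          using match[of "2 * ?k"] k by (auto simp: max_def split: if_splits)
      qed
      moreover have "i < 2 * int k \<or> i = 2 * int k + 1" if "i \<in> {0..<2 * int (Suc k)}" "odd i" for i
        using that by (auto, presburger)
      moreover have "\<forall>i\<in>{0..<2 * int k}. odd i \<longrightarrow> c i < 0"
        using Suc by simp
      ultimately show ?case
        by (metis atLeastLessThan_iff)
    qed
    from this[of "nat (n div 2)"] have "\<forall>i\<in>{0..<2 * (n div 2)}. odd i \<longrightarrow> c i < 0"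
      using \<open>n \<ge> 2\<close> by simp
    moreover have "n div 2 \<in> {1..n div 2}" "2 * (n div 2) = n"
      using \<open>even n\<close> \<open>n \<ge> 2\<close> by auto
    ultimately show False
      using none by blast
  qed
qed

section \<open>The toric map\<close>

definition xmon :: "int \<Rightarrow> int \<Rightarrow> monom" where
  "xmon n i = Poly_Mapping.single (X (i mod n)) 1"

definition ymon :: "int \<Rightarrow> int \<Rightarrow> monom" where
  "ymon n i = Poly_Mapping.single (Y (i mod n)) 1"

definition path_exp :: "int \<Rightarrow> int \<Rightarrow> monom" where
  "path_exp n j = (\<Sum>i\<in>{j..j + n - 3}. xmon n i)"

lemma x_var_eq: "x_var n i = monom_poly (xmon n i)"
  by (simp add: x_var_def xmon_def)

lemma y_var_eq: "y_var n i = monom_poly (ymon n i)"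
  by (simp add: y_var_def ymon_def)

lemma path_monom_eq: "path_monom n j = monom_poly (path_exp n j)"
  by (simp add: path_monom_def path_exp_def monom_poly_sum x_var_eq)

lemma xmon_mod [simp]: "xmon n (i mod n) = xmon n i"
  by (simp add: xmon_def)

lemma xmon_cong: "i mod n = j mod n \<Longrightarrow> xmon n i = xmon n j"
  by (simp add: xmon_def)

lemma ymon_cong: "i mod n = j mod n \<Longrightarrow> ymon n i = ymon n j"
  by (simp add: ymon_def)

lemma xmon_in_monoms: "n > 0 \<Longrightarrow> xmon n i \<in> monoms (xvars n)"
  by (simp add: xmon_def xvars_def monoms_single)

lemma ymon_in_monoms: "n > 0 \<Longrightarrow> ymon n i \<in> monoms (yvars n)"
  by (simp add: ymon_def yvars_def monoms_single)

lemma sum_window_mod: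
  fixes n :: int
  assumes "n > 0"
  shows "(\<Sum>i\<in>{j..<j + n}. f (i mod n)) = (\<Sum>i\<in>{0..<n}. f i)"
proof (rule sum.reindex_bij_witness[of _ "\<lambda>i. j + (i - j) mod n" "\<lambda>i. i mod n"])
  fix i assume "i \<in> {j..<j + n}"
  then show "j + (i mod n - j) mod n = i"
    by (simp add: mod_diff_left_eq)
next
  fix i assume "i \<in> {0..<n}"
  then show "(j + (i - j) mod n) mod n = i"
    by (simp add: mod_add_right_eq)
qed (use assms in auto)

text \<open>
  The \<open>n\<close> consecutive indices from \<open>j\<close> on meet every residue once, and the path \<open>u\<^sub>j\<close> leaves out the
  last two of them, which are \<open>j - 2\<close> and \<open>j - 1\<close>.
\<close>

lemma path_exp_complement:
  assumes "n \<ge> 2"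
  shows "path_exp n j + xmon n (j - 2) + xmon n (j - 1) = (\<Sum>i\<in>{0..<n}. xmon n i)"
proof -
  have "{j..<j + n} = insert (j + n - 2) (insert (j + n - 1) {j..j + n - 3})"
    using assms by auto
  then have "(\<Sum>i\<in>{j..<j + n}. xmon n i) = path_exp n j + xmon n (j + n - 2) + xmon n (j + n - 1)"
    by (simp add: path_exp_def add_ac)
  moreover have "xmon n (j + n - 2) = xmon n (j - 2)" "xmon n (j + n - 1) = xmon n (j - 1)"
    using mod_add_self2[of "j - 2" n] mod_add_self2[of "j - 1" n]
    by (auto intro!: xmon_cong simp: algebra_simps)
  moreover have "(\<Sum>i\<in>{j..<j + n}. xmon n i) = (\<Sum>i\<in>{0..<n}. xmon n i)"
    using sum_window_mod[of n "xmon n" j] assms by simp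
  ultimately show ?thesis
    by simp
qed

text \<open>
  Both \<open>x\<^bsub>j-2\<^esub> u\<^sub>j\<close> and \<open>x\<^sub>j u\<^bsub>j+1\<^esub>\<close> are the product of all variables except \<open>x\<^bsub>j-1\<^esub>\<close>: this is the
  linear relation behind \<open>f\<^sub>j\<close>.
\<close>

lemma path_exp_neighbours:
  assumes "n \<ge> 2"
  shows "xmon n (j - 2) + path_exp n j = xmon n j + path_exp n (j + 1)"
proof -
  have "path_exp n j + xmon n (j - 2) + xmon n (j - 1) =
      path_exp n (j + 1) + xmon n (j - 1) + xmon n j"
    using path_exp_complement[OF assms, of j] path_exp_complement[OF assms, of "j + 1"] by simp
  then have "(xmon n (j - 2) + path_exp n j) + xmon n (j - 1) =
      (xmon n j + path_exp n (j + 1)) + xmon n (j - 1)"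
    by (simp add: add_ac)
  then show ?thesis
    by (rule add_right_imp_eq)
qed

lemma path_exp_mod: "n \<ge> 2 \<Longrightarrow> path_exp n (j mod n) = path_exp n j"
proof -
  assume n: "n \<ge> 2"
  have "xmon n (j mod n - k) = xmon n (j - k)" for k
    by (rule xmon_cong) (simp add: mod_diff_left_eq)
  then have "path_exp n (j mod n) + (xmon n (j - 2) + xmon n (j - 1)) =
      path_exp n j + (xmon n (j - 2) + xmon n (j - 1))"
    using path_exp_complement[OF n, of "j mod n"] path_exp_complement[OF n, of j]
    by (simp add: add_ac)
  then show ?thesis
    by (rule add_right_imp_eq)
qed

text \<open>
  The exponents of the toric map \<open>x\<^sub>i \<mapsto> x\<^sub>i\<close>, \<open>y\<^sub>j \<mapsto> u\<^sub>j t\<close> into \<open>S[t]\<close>. In the target the name \<open>Y 0\<close>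
  stands for the extra variable \<open>t\<close>.
\<close>

primrec var_weight :: "int \<Rightarrow> var \<Rightarrow> monom" where
  "var_weight n (X i) = Poly_Mapping.single (X i) 1"
| "var_weight n (Y j) = path_exp n j + Poly_Mapping.single (Y 0) 1"

definition weight :: "int \<Rightarrow> monom \<Rightarrow> monom" where
  "weight n m = (\<Sum>v\<in>Poly_Mapping.keys m. \<Sum>_<Poly_Mapping.lookup m v. var_weight n v)"

lemma weight_add: "weight n (a + b) = weight n a + weight n b"
proof -
  have *: "(\<Sum>_<k + l. c) = (\<Sum>_<k. c) + (\<Sum>_<l. c)" for k l :: nat and c :: monom
    by (induction l) (simp_all add: add_ac)
  show ?thesis
    unfolding weight_def by (rule setsum_keys_plus_distrib) (simp_all add: *)
qed

lemma weight_single: "weight n (Poly_Mapping.single v 1) = var_weight n v"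
  by (simp add: weight_def)

lemma weight_ymon: "n \<ge> 2 \<Longrightarrow> weight n (ymon n i) = path_exp n i + Poly_Mapping.single (Y 0) 1"
  unfolding ymon_def weight_single by (simp add: path_exp_mod)

lemma lookup_weight:
  "Poly_Mapping.lookup (weight n m) t =
     (\<Sum>v\<in>Poly_Mapping.keys m. Poly_Mapping.lookup m v * Poly_Mapping.lookup (var_weight n v) t)"
  by (simp add: weight_def lookup_sum)

lemma weight_xvars:
  assumes "m \<in> monoms (xvars n)"
  shows "weight n m = m"
proof (rule poly_mapping_eqI)
  fix t
  have "Poly_Mapping.lookup (weight n m) t =
      (\<Sum>v\<in>Poly_Mapping.keys m. if v = t then Poly_Mapping.lookup m v else 0)"
    unfolding lookup_weight using assms
    by (intro sum.cong) (auto simp: monoms_def xvars_def lookup_single when_def)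
  then show "Poly_Mapping.lookup (weight n m) t = Poly_Mapping.lookup m t"
    by (simp add: in_keys_iff)
qed

lemma sum_keys_xy:
  fixes F :: "var \<Rightarrow> nat"
  assumes "m \<in> monoms (xvars n \<union> yvars n)"
  shows "(\<Sum>v\<in>Poly_Mapping.keys m. Poly_Mapping.lookup m v * F v) =
    (\<Sum>i\<in>{0..<n}. Poly_Mapping.lookup m (X i) * F (X i)) +
    (\<Sum>j\<in>{0..<n}. Poly_Mapping.lookup m (Y j) * F (Y j))"
proof -
  have "(\<Sum>v\<in>Poly_Mapping.keys m. Poly_Mapping.lookup m v * F v) =
      (\<Sum>v\<in>xvars n \<union> yvars n. Poly_Mapping.lookup m v * F v)"
    using assms by (intro sum.mono_neutral_left) (auto simp: monoms_def xvars_def yvars_def in_keys_iff)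
  also have "\<dots> = (\<Sum>v\<in>xvars n. Poly_Mapping.lookup m v * F v) +
      (\<Sum>v\<in>yvars n. Poly_Mapping.lookup m v * F v)"
    by (rule sum.union_disjoint) (auto simp: xvars_def yvars_def)
  finally show ?thesis
    unfolding xvars_def yvars_def by (simp add: sum.reindex inj_on_def)
qed

lemma lookup_weight_Y0:
  assumes "m \<in> monoms (xvars n \<union> yvars n)"
  shows "Poly_Mapping.lookup (weight n m) (Y 0) = (\<Sum>j\<in>{0..<n}. Poly_Mapping.lookup m (Y j))"
  unfolding lookup_weight sum_keys_xy[OF assms]
  by (simp add: lookup_add path_exp_def lookup_sum xmon_def lookup_single when_def)

text \<open>
  The variable \<open>x\<^sub>i\<close> divides every \<open>u\<^sub>j\<close> except \<open>u\<^bsub>i+1\<^esub>\<close> and \<open>u\<^bsub>i+2\<^esub>\<close>. The two exceptional terms are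
  added on the left to avoid subtraction of natural numbers.
\<close>

lemma lookup_weight_X:
  assumes m: "m \<in> monoms (xvars n \<union> yvars n)" and n: "n \<ge> 2"
  shows "Poly_Mapping.lookup (weight n m) (X (i mod n)) + Poly_Mapping.lookup m (Y ((i + 1) mod n)) +
      Poly_Mapping.lookup m (Y ((i + 2) mod n)) =
    Poly_Mapping.lookup m (X (i mod n)) + (\<Sum>j\<in>{0..<n}. Poly_Mapping.lookup m (Y j))"
proof -
  let ?b = "\<lambda>j. Poly_Mapping.lookup m (Y j)" and ?t = "X (i mod n)"
  let ?is = "\<lambda>j. if j mod n = i mod n then 1 else 0 :: nat"
  have "Poly_Mapping.lookup (\<Sum>l\<in>{0..<n}. xmon n l) ?t = (\<Sum>l\<in>{0..<n}. if l = i mod n then 1 else 0)"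
    unfolding lookup_sum by (intro sum.cong) (auto simp: xmon_def lookup_single when_def)
  also have "\<dots> = 1"
    using n by simp
  finally have "Poly_Mapping.lookup (path_exp n j + xmon n (j - 2) + xmon n (j - 1)) ?t = 1" for j
    using path_exp_complement[OF n, of j] by simp
  moreover have "Poly_Mapping.lookup (xmon n j) ?t = ?is j" for j
    by (simp add: xmon_def lookup_single when_def)
  ultimately have path: "Poly_Mapping.lookup (path_exp n j) ?t + ?is (j - 2) + ?is (j - 1) = 1" for j
    by (simp only: lookup_add)
  have shift: "(\<Sum>j\<in>{0..<n}. ?b j * ?is (j - k)) = ?b ((i + k) mod n)" for k
  proof -
    have "(j - k) mod n = i mod n \<longleftrightarrow> j = (i + k) mod n" if "j \<in> {0..<n}" for j
    proof -
      have "(j - k) mod n = i mod n \<longleftrightarrow> j mod n = (i + k) mod n"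
        by (simp add: mod_eq_dvd_iff algebra_simps)
      then show ?thesis
        using that by simp
    qed
    then have "(\<Sum>j\<in>{0..<n}. ?b j * ?is (j - k)) = (\<Sum>j\<in>{0..<n}. if j = (i + k) mod n then ?b j else 0)"
      by (intro sum.cong) auto
    then show ?thesis
      using n by simp
  qed
  have "(\<Sum>l\<in>{0..<n}. Poly_Mapping.lookup m (X l) * Poly_Mapping.lookup (var_weight n (X l)) ?t) =
      (\<Sum>l\<in>{0..<n}. if l = i mod n then Poly_Mapping.lookup m (X l) else 0)"
    by (intro sum.cong) (auto simp: lookup_single when_def)
  also have "\<dots> = Poly_Mapping.lookup m ?t"
    using n by simp
  finally have x: "(\<Sum>l\<in>{0..<n}. Poly_Mapping.lookup m (X l) * Poly_Mapping.lookup (var_weight n (X l)) ?t) =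
    Poly_Mapping.lookup m ?t" .
  have y: "(\<Sum>j\<in>{0..<n}. ?b j * Poly_Mapping.lookup (var_weight n (Y j)) ?t) =
      (\<Sum>j\<in>{0..<n}. ?b j * Poly_Mapping.lookup (path_exp n j) ?t)"
    by (simp add: lookup_add lookup_single when_def)
  have "(\<Sum>j\<in>{0..<n}. ?b j) =
      (\<Sum>j\<in>{0..<n}. ?b j * (Poly_Mapping.lookup (path_exp n j) ?t + ?is (j - 2) + ?is (j - 1)))"
    by (simp only: path mult_1_right)
  also have "\<dots> = (\<Sum>j\<in>{0..<n}. ?b j * Poly_Mapping.lookup (path_exp n j) ?t) +
      ?b ((i + 2) mod n) + ?b ((i + 1) mod n)"
    by (simp only: distrib_left sum.distrib shift)
  finally show ?thesis
    unfolding lookup_weight sum_keys_xy[OF m] x y by simp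
qed

text \<open>
  The exponent of \<open>t\<close> equates the degrees in \<open>y\<close>. After cancelling them, the exponent of \<open>x\<^sub>i\<close>
  expresses the change of \<open>x\<^sub>i\<close> through the changes of \<open>y\<^bsub>i+1\<^esub>\<close> and \<open>y\<^bsub>i+2\<^esub>\<close>.
\<close>

lemma weight_fibre:
  assumes m: "m \<in> monoms (xvars n \<union> yvars n)" and m': "m' \<in> monoms (xvars n \<union> yvars n)"
    and n: "n \<ge> 2" and eq: "weight n m' = weight n m"
  shows "(\<Sum>j\<in>{0..<n}. Poly_Mapping.lookup m' (Y j)) = (\<Sum>j\<in>{0..<n}. Poly_Mapping.lookup m (Y j))"
    and "Poly_Mapping.lookup m (X (i mod n)) +
        Poly_Mapping.lookup m' (Y ((i + 1) mod n)) + Poly_Mapping.lookup m' (Y ((i + 2) mod n)) =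
      Poly_Mapping.lookup m' (X (i mod n)) +
        Poly_Mapping.lookup m (Y ((i + 1) mod n)) + Poly_Mapping.lookup m (Y ((i + 2) mod n))"
proof -
  show "(\<Sum>j\<in>{0..<n}. Poly_Mapping.lookup m' (Y j)) = (\<Sum>j\<in>{0..<n}. Poly_Mapping.lookup m (Y j))"
    using lookup_weight_Y0[OF m] lookup_weight_Y0[OF m'] eq by simp
  then show "Poly_Mapping.lookup m (X (i mod n)) +
        Poly_Mapping.lookup m' (Y ((i + 1) mod n)) + Poly_Mapping.lookup m' (Y ((i + 2) mod n)) =
      Poly_Mapping.lookup m' (X (i mod n)) +
        Poly_Mapping.lookup m (Y ((i + 1) mod n)) + Poly_Mapping.lookup m (Y ((i + 2) mod n))"
    using lookup_weight_X[OF m n, of i] lookup_weight_X[OF m' n, of i] eq by simp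
qed

section \<open>The generators as binomials\<close>

definition odd_y :: "int \<Rightarrow> int \<Rightarrow> monom" where
  "odd_y n m = (\<Sum>i\<in>{i\<in>{0..<m}. odd i}. ymon n i)"

definition even_y :: "int \<Rightarrow> int \<Rightarrow> monom" where
  "even_y n m = (\<Sum>i\<in>{i\<in>{0..<m}. even i}. ymon n i)"

lemma prod_y_var: "(\<Prod>i\<in>A. y_var n i) = monom_poly (\<Sum>i\<in>A. ymon n i)"
  by (simp add: y_var_eq monom_poly_sum)

lemma f_poly_eq:
  "f_poly n j = monom_poly (xmon n (j - 2) + ymon n j) - monom_poly (xmon n j + ymon n (j + 1))"
  by (simp add: f_poly_def x_var_eq y_var_eq monom_poly_add)

lemma g_poly_eq:
  "g_poly n k = monom_poly (xmon n (2 * k - 2) + odd_y n (2 * k)) -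
     monom_poly (xmon n (n - 2) + even_y n (2 * k))"
  unfolding g_poly_def odd_y_def even_y_def by (simp only: x_var_eq prod_y_var monom_poly_add)

lemma h_poly_eq: "h_poly n = monom_poly (odd_y n n) - monom_poly (even_y n n)"
  unfolding h_poly_def odd_y_def even_y_def by (simp only: prod_y_var)

lemma odd_y_in_monoms: "n > 0 \<Longrightarrow> odd_y n m \<in> monoms (yvars n)"
  and even_y_in_monoms: "n > 0 \<Longrightarrow> even_y n m \<in> monoms (yvars n)"
  unfolding odd_y_def even_y_def by (auto intro!: monoms_sum ymon_in_monoms)

lemma odd_y_step:
  assumes "even m" and "m \<ge> 0"
  shows "odd_y n (m + 2) = odd_y n m + ymon n (m + 1)"
proof -
  have "{i\<in>{0..<m + 2}. odd i} = insert (m + 1) {i\<in>{0..<m}. odd i}"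
    using assms by (auto, presburger)
  moreover have "m + 1 \<notin> {i\<in>{0..<m}. odd i}" "finite {i\<in>{0..<m}. odd i}"
    by (auto intro: finite_subset[of _ "{0..<m}"])
  ultimately show ?thesis
    unfolding odd_y_def by (metis (no_types, lifting) sum.insert add.commute)
qed

lemma even_y_step:
  assumes "even m" and "m \<ge> 0"
  shows "even_y n (m + 2) = even_y n m + ymon n m"
proof -
  have "{i\<in>{0..<m + 2}. even i} = insert m {i\<in>{0..<m}. even i}"
    using assms by (auto, presburger)
  moreover have "m \<notin> {i\<in>{0..<m}. even i}" "finite {i\<in>{0..<m}. even i}"
    by (auto intro: finite_subset[of _ "{0..<m}"])
  ultimately show ?thesis
    unfolding even_y_def by (metis (no_types, lifting) sum.insert add.commute)
qed

text \<open>
  Multiplying \<open>g\<^sub>k\<close> by \<open>y\<^bsub>2k\<^esub>\<close> completes its even product; the first term then contains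
  \<open>x\<^bsub>2k-2\<^esub> y\<^bsub>2k\<^esub>\<close>, which \<open>f\<^bsub>2k\<^esub>\<close> exchanges for \<open>x\<^bsub>2k\<^esub> y\<^bsub>2k+1\<^esub>\<close>.
\<close>

lemma g_poly_step:
  assumes "k \<ge> 0"
  shows "g_poly n (k + 1) = monom_poly (ymon n (2 * k)) * g_poly n k -
    monom_poly (odd_y n (2 * k)) * f_poly n (2 * k)"
proof -
  have "2 * (k + 1) = 2 * k + 2"
    by simp
  then have "g_poly n (k + 1) =
      monom_poly (xmon n (2 * k)) * (monom_poly (odd_y n (2 * k)) * monom_poly (ymon n (2 * k + 1))) -
      monom_poly (xmon n (n - 2)) * (monom_poly (even_y n (2 * k)) * monom_poly (ymon n (2 * k)))"
    unfolding g_poly_eq using assms by (simp add: odd_y_step even_y_step monom_poly_add)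
  then show ?thesis
    unfolding g_poly_eq f_poly_eq by (simp add: monom_poly_add algebra_simps)
qed

section \<open>The ideal lies between the generators and the toric ideal\<close>

lemma toric_ideal_binomial:
  assumes "a \<in> monoms V" and "b \<in> monoms V"
  shows "monom_poly a - monom_poly b \<in> toric_ideal V w \<longleftrightarrow> w a = w b"
  using assms
  by (simp add: toric_ideal_def push_forward_diff push_forward_monom_poly monom_poly_inject
      monom_poly_closed poly_ring_diff_closed)

text \<open>
  The toric map fixes the coefficients \<open>a\<^sub>i \<in> S\<close>, so it sends \<open>\<Sum> a\<^sub>i y\<^sub>i\<close> to \<open>t \<Sum> a\<^sub>i u\<^sub>i = 0\<close>.
\<close>

lemma sym_ideal_generators_subset_toric:
  assumes n: "n \<ge> 2"
  shows "{(\<Sum>i\<in>{1..n}. a i * y_var n i) | a. (\<forall>i\<in>{1..n}. a i \<in> carrier (S_ring n)) \<and>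
      (\<Sum>i\<in>{1..n}. a i * path_monom n i) = 0} \<subseteq>
    (toric_ideal (xvars n \<union> yvars n) (weight n) :: 'k::field mpoly set)"
proof clarify
  fix a :: "int \<Rightarrow> 'k mpoly"
  assume a: "\<forall>i\<in>{1..n}. a i \<in> carrier (S_ring n)" and rel: "(\<Sum>i\<in>{1..n}. a i * path_monom n i) = 0"
  let ?t = "monom_poly (Poly_Mapping.single (Y 0) 1) :: 'k mpoly"
  have fixed: "push_forward (weight n) (a i) = a i" if "i \<in> {1..n}" for i
    using a that by (intro push_forward_fixed weight_xvars) (auto simp: carrier_poly_ring)
  have "push_forward (weight n) (\<Sum>i\<in>{1..n}. a i * y_var n i) =
      (\<Sum>i\<in>{1..n}. a i * (path_monom n i * ?t))"
    unfolding push_forward_sum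
  proof (rule sum.cong)
    fix i assume "i \<in> {1..n}"
    then show "push_forward (weight n) (a i * y_var n i) = a i * (path_monom n i * ?t)"
      by (simp only: push_forward_mult[of "weight n", OF weight_add] fixed y_var_eq
          push_forward_monom_poly weight_ymon[OF n] monom_poly_add path_monom_eq)
  qed simp
  also have "\<dots> = (\<Sum>i\<in>{1..n}. a i * path_monom n i) * ?t"
    by (simp add: sum_distrib_right mult.assoc)
  finally have "push_forward (weight n) (\<Sum>i\<in>{1..n}. a i * y_var n i) = 0"
    using rel by simp
  moreover have "(\<Sum>i\<in>{1..n}. a i * y_var n i) \<in> carrier (T_ring n)"
  proof (rule poly_ring_sum_closed)
    fix i assume "i \<in> {1..n}"
    then have "a i \<in> carrier (T_ring n)"
      using a poly_ring_mono[of "xvars n" "xvars n \<union> yvars n"] by blast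
    moreover have "(y_var n i :: 'k mpoly) \<in> carrier (T_ring n)"
      using ymon_in_monoms[of n i] n monoms_mono[of "yvars n" "xvars n \<union> yvars n"]
      by (auto simp: y_var_eq monom_poly_closed)
    ultimately show "a i * y_var n i \<in> carrier (T_ring n)"
      by (rule poly_ring_mult_closed)
  qed
  ultimately show "(\<Sum>i\<in>{1..n}. a i * y_var n i) \<in> toric_ideal (xvars n \<union> yvars n) (weight n)"
    by (simp add: toric_ideal_def)
qed

lemma sym_ideal_subset_toric:
  "n \<ge> 2 \<Longrightarrow> sym_ideal n \<subseteq> toric_ideal (xvars n \<union> yvars n) (weight n)"
  unfolding sym_ideal_def
  by (intro ring.genideal_minimal[OF ring_poly_ring] ideal_toric_ideal
      sym_ideal_generators_subset_toric weight_add)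

lemma toric_ideal_subset_carrier: "toric_ideal V w \<subseteq> carrier (poly_ring V)"
  by (auto simp: toric_ideal_def)

lemma ideal_sym_ideal:
  assumes "n \<ge> 2"
  shows "ideal (sym_ideal n :: 'k::field mpoly set) (T_ring n)"
  unfolding sym_ideal_def
  by (rule ring.genideal_ideal[OF ring_poly_ring])
    (rule order_trans[OF sym_ideal_generators_subset_toric[OF assms] toric_ideal_subset_carrier])

lemma sym_ideal_binomial:
  assumes n: "n \<ge> 2" and ij: "i \<in> {1..n}" "j \<in> {1..n}" "i \<noteq> j"
    and u: "u \<in> monoms (xvars n)" "v \<in> monoms (xvars n)"
    and rel: "u + path_exp n i = v + path_exp n j"
  shows "monom_poly (u + ymon n i) - monom_poly (v + ymon n j) \<in> (sym_ideal n :: 'k::field mpoly set)"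
proof -
  define a :: "int \<Rightarrow> 'k mpoly"
    where "a l = (if l = i then monom_poly u else if l = j then - monom_poly v else 0)" for l
  have sum: "(\<Sum>l\<in>{1..n}. a l * F l) = monom_poly u * F i - monom_poly v * F j" for F
  proof -
    have "(\<Sum>l\<in>{1..n}. a l * F l) = (\<Sum>l\<in>{i, j}. a l * F l)"
      using ij by (intro sum.mono_neutral_right) (auto simp: a_def)
    then show ?thesis
      using ij by (simp add: a_def)
  qed
  have "(\<Sum>l\<in>{1..n}. a l * path_monom n l) = 0"
    unfolding sum path_monom_eq using rel by (simp flip: monom_poly_add)
  moreover have "a l \<in> carrier (S_ring n)" for l
    using u by (simp add: a_def monom_poly_closed poly_ring_uminus_closed)
  ultimately have "(\<Sum>l\<in>{1..n}. a l * y_var n l) \<in> sym_ideal n"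
    unfolding sym_ideal_def
    by (intro subsetD[OF ring.genideal_self[OF ring_poly_ring]])
      (use order_trans[OF sym_ideal_generators_subset_toric[OF n] toric_ideal_subset_carrier] in blast)+
  then show ?thesis
    unfolding sum y_var_eq by (simp add: monom_poly_add)
qed

lemma f_poly_in_sym_ideal:
  assumes n: "n \<ge> 2" and j: "j \<in> {1..n - 1}"
  shows "f_poly n j \<in> sym_ideal n"
  unfolding f_poly_eq
  by (rule sym_ideal_binomial) (use assms xmon_in_monoms path_exp_neighbours in auto)

text \<open>
  Up to sign, \<open>g\<^sub>1\<close> is the binomial \<open>f\<^sub>n\<close> of the relation between \<open>u\<^sub>n\<close> and \<open>u\<^sub>1\<close>, which closes the
  cycle. The other \<open>g\<^sub>k\<close> follow recursively.
\<close>

lemma g_poly_in_sym_ideal: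
  assumes n: "n \<ge> 2" and k: "k \<ge> 1" "2 * k \<le> n"
  shows "g_poly n k \<in> (sym_ideal n :: 'k::field mpoly set)"
  using k
proof (induction k rule: int_ge_induct)
  case base
  have "{i\<in>{0..<2}. odd i} = {1::int}" "{i\<in>{0..<2}. even i} = {0::int}"
    by (auto, presburger)
  then have y: "odd_y n 2 = ymon n 1" "even_y n 2 = ymon n 0"
    by (simp_all only: odd_y_def even_y_def sum.insert_remove) simp_all
  have wrap: "xmon n n = xmon n 0" "ymon n n = ymon n 0" "path_exp n (n + 1) = path_exp n 1"
    using path_exp_mod[OF n, of "n + 1"] path_exp_mod[OF n, of 1]
    by (auto intro!: xmon_cong ymon_cong)
  have rel: "xmon n 0 + path_exp n 1 = xmon n (n - 2) + path_exp n n"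
    using path_exp_neighbours[OF n, of n] wrap by simp
  have "monom_poly (xmon n 0 + ymon n 1) - monom_poly (xmon n (n - 2) + ymon n n) \<in>
      (sym_ideal n :: 'k mpoly set)"
    by (rule sym_ideal_binomial) (use n xmon_in_monoms rel in auto)
  then show ?case
    unfolding g_poly_eq by (simp add: y wrap)
next
  case (step k)
  have "(monom_poly (ymon n (2 * k)) :: 'k mpoly) \<in> carrier (T_ring n)"
    "(monom_poly (odd_y n (2 * k)) :: 'k mpoly) \<in> carrier (T_ring n)"
    using ymon_in_monoms odd_y_in_monoms n monoms_mono[of "yvars n" "xvars n \<union> yvars n"]
    by (force simp: monom_poly_closed)+
  moreover have "g_poly n k \<in> (sym_ideal n :: 'k mpoly set)"
    using step by simp
  moreover have "f_poly n (2 * k) \<in> (sym_ideal n :: 'k mpoly set)"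
    using step by (intro f_poly_in_sym_ideal[OF n]) simp
  ultimately have "monom_poly (ymon n (2 * k)) * g_poly n k -
      monom_poly (odd_y n (2 * k)) * f_poly n (2 * k) \<in> (sym_ideal n :: 'k mpoly set)"
    by (intro ideal_poly_ring_diff[OF ideal_sym_ideal[OF n]]
        ideal_poly_ring_closed(4)[OF ideal_sym_ideal[OF n]])
  then show ?case
    using step(1) by (simp add: g_poly_step)
qed

text \<open>
  For \<open>k = n/2\<close> the two \<open>x\<close>-factors of \<open>g\<^sub>k\<close> coincide, so that \<open>g\<^bsub>n/2\<^esub> = x\<^bsub>n-2\<^esub> h\<close>. As \<open>g\<^bsub>n/2\<^esub>\<close> is in the
  toric ideal, the image of \<open>x\<^bsub>n-2\<^esub>\<close> can be cancelled from those of its two terms.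
\<close>

lemma h_poly_in_toric_ideal:
  assumes n: "n \<ge> 2" "even n"
  shows "h_poly n \<in> (toric_ideal (yvars n) (weight n) :: 'k::field mpoly set)"
proof -
  have mon: "odd_y n n \<in> monoms (yvars n)" "even_y n n \<in> monoms (yvars n)"
    "xmon n (n - 2) \<in> monoms (xvars n)"
    using n odd_y_in_monoms even_y_in_monoms xmon_in_monoms by auto
  have g: "(g_poly n (n div 2) :: 'k mpoly) =
      monom_poly (xmon n (n - 2) + odd_y n n) - monom_poly (xmon n (n - 2) + even_y n n)"
    unfolding g_poly_eq using n by simp
  have "(g_poly n (n div 2) :: 'k mpoly) \<in> toric_ideal (xvars n \<union> yvars n) (weight n)"
    by (rule subsetD[OF sym_ideal_subset_toric[OF n(1)]], rule g_poly_in_sym_ideal[OF n(1)])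
      (use n in auto)
  then have "weight n (xmon n (n - 2) + odd_y n n) = weight n (xmon n (n - 2) + even_y n n)"
    unfolding g using mon monoms_mono[of "yvars n" "xvars n \<union> yvars n"]
      monoms_mono[of "xvars n" "xvars n \<union> yvars n"]
    by (subst (asm) toric_ideal_binomial) (auto intro!: monoms_add)
  then have "weight n (odd_y n n) = weight n (even_y n n)"
    by (simp add: weight_add)
  then show ?thesis
    unfolding h_poly_eq using toric_ideal_binomial[OF mon(1,2)] by blast
qed

lemma H_ideal_subset_toric:
  "n \<ge> 2 \<Longrightarrow> even n \<Longrightarrow> H_ideal n \<subseteq> toric_ideal (yvars n) (weight n)"
  unfolding H_ideal_def
  by (rule ring.genideal_minimal[OF ring_poly_ring])
    (auto intro: ideal_toric_ideal weight_add h_poly_in_toric_ideal)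

lemma toric_ideal_mono: "V \<subseteq> W \<Longrightarrow> toric_ideal V w \<subseteq> toric_ideal W w"
  using poly_ring_mono unfolding toric_ideal_def by blast

lemma HT_ideal_subset_toric:
  assumes "n \<ge> 2" and "even n"
  shows "HT_ideal n \<subseteq> toric_ideal (xvars n \<union> yvars n) (weight n)"
  unfolding HT_ideal_def
  using H_ideal_subset_toric[OF assms] toric_ideal_mono[of "yvars n" "xvars n \<union> yvars n" "weight n"]
  by (intro ring.genideal_minimal[OF ring_poly_ring] ideal_toric_ideal weight_add) blast

lemma ideal_HT_ideal:
  assumes "n \<ge> 2" and "even n"
  shows "ideal (HT_ideal n :: 'k::field mpoly set) (T_ring n)"
    and "h_poly n \<in> (HT_ideal n :: 'k mpoly set)"
proof -
  have H: "(H_ideal n :: 'k mpoly set) \<subseteq> carrier (T_ring n)"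
    using H_ideal_subset_toric[OF assms] toric_ideal_mono[of "yvars n" "xvars n \<union> yvars n" "weight n"]
      toric_ideal_subset_carrier by blast
  then show "ideal (HT_ideal n :: 'k mpoly set) (T_ring n)"
    unfolding HT_ideal_def by (rule ring.genideal_ideal[OF ring_poly_ring])
  have "h_poly n \<in> (H_ideal n :: 'k mpoly set)"
    unfolding H_ideal_def
    using h_poly_in_toric_ideal[OF assms] toric_ideal_subset_carrier
    by (intro ring.genideal_self'[OF ring_poly_ring]) blast
  then show "h_poly n \<in> (HT_ideal n :: 'k mpoly set)"
    unfolding HT_ideal_def using ring.genideal_self[OF ring_poly_ring H] by blast
qed

lemma mem_set_add_poly_ring: "x \<in> set_add (poly_ring V) A B \<longleftrightarrow> (\<exists>a\<in>A. \<exists>b\<in>B. x = a + b)"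
  by (auto simp: set_add_def')

lemma sum_ideal_subset_toric:
  assumes "n \<ge> 2" and "even n"
  shows "set_add (T_ring n) (sym_ideal n) (HT_ideal n) \<subseteq> toric_ideal (xvars n \<union> yvars n) (weight n)"
  using sym_ideal_subset_toric[OF assms(1)] HT_ideal_subset_toric[OF assms]
    ideal_poly_ring_closed(3)[OF ideal_toric_ideal[of "weight n", OF weight_add]]
  unfolding subset_iff mem_set_add_poly_ring by metis

lemma generators_in_sum_ideal:
  assumes "n \<ge> 2" and "even n"
  shows "f_poly n ` {1..n - 1} \<union> g_poly n ` {1..n div 2} \<union> {h_poly n} \<subseteq>
    (set_add (T_ring n) (sym_ideal n) (HT_ideal n) :: 'k::field mpoly set)"
proof -
  have "p \<in> set_add (T_ring n) (sym_ideal n) (HT_ideal n)"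
    if "p \<in> sym_ideal n \<or> p \<in> HT_ideal n" for p :: "'k mpoly"
    using that ideal_poly_ring_closed(2)[OF ideal_sym_ideal[OF assms(1)]]
      ideal_poly_ring_closed(2)[OF ideal_HT_ideal(1)[OF assms]]
    unfolding mem_set_add_poly_ring by (metis add_0 add.right_neutral)
  moreover have "f_poly n j \<in> (sym_ideal n :: 'k mpoly set)" if "j \<in> {1..n - 1}" for j
    using f_poly_in_sym_ideal[OF assms(1) that] .
  moreover have "g_poly n k \<in> (sym_ideal n :: 'k mpoly set)" if "k \<in> {1..n div 2}" for k
    using that by (intro g_poly_in_sym_ideal[OF assms(1)]) auto
  ultimately show ?thesis
    using ideal_HT_ideal(2)[OF assms] by blast
qed

section \<open>Leading monomials\<close>

lemma total_deg_add: "total_deg (a + b) = total_deg a + total_deg b"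
  unfolding total_deg_def by (rule setsum_keys_plus_distrib) simp_all

lemma total_deg_sum: "total_deg (sum f A) = (\<Sum>i\<in>A. total_deg (f i))"
  by (induction A rule: infinite_finite_induct) (simp_all add: total_deg_add, simp_all add: total_deg_def)

lemma total_deg_ymon: "total_deg (ymon n i) = 1"
  by (simp add: total_deg_def ymon_def)

lemma mod_eq_iff_on_period:
  fixes n :: int
  assumes "i \<in> {1..n}" and "j \<in> {1..n}"
  shows "i mod n = j mod n \<longleftrightarrow> i = j"
  using assms by (cases "i = n"; cases "j = n") auto

text \<open>
  The position of \<open>y\<^bsub>j+1\<^esub>\<close> in \<open>y\<^sub>1 > \<dots> > y\<^sub>n\<close> decides; here \<open>y\<^sub>n = y\<^sub>0\<close>, which is why \<open>j < n\<close>.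
\<close>

lemma revlex_ymon_succ:
  assumes j: "j \<in> {1..n - 1}"
  shows "revlex n (\<lambda>i. Y (i mod n)) (ymon n (j + 1)) (ymon n j)"
proof -
  have lookup: "Poly_Mapping.lookup (ymon n k) (Y (l mod n)) = (if l = k then 1 else 0)"
    if "k \<in> {1..n}" "l \<in> {1..n}" for k l
    using mod_eq_iff_on_period[OF that] by (auto simp: ymon_def lookup_single when_def)
  show ?thesis
    unfolding revlex_def
    by (rule disjI2, rule conjI, simp add: total_deg_ymon, rule bexI[of _ "j + 1"])
      (use j in \<open>auto simp: lookup\<close>)
qed

lemma lookup_sum_ymon:
  assumes "A \<subseteq> {0..<n}"
  shows "Poly_Mapping.lookup (\<Sum>i\<in>A. ymon n i) t = (if t \<in> Y ` A then 1 else 0)"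
proof -
  have "finite A"
    using assms finite_subset by blast
  have "Poly_Mapping.lookup (\<Sum>i\<in>A. ymon n i) t = (\<Sum>i\<in>A. if Y i = t then 1 else 0)"
    unfolding lookup_sum using assms
    by (intro sum.cong) (auto simp: ymon_def lookup_single when_def)
  also have "\<dots> = (if t \<in> Y ` A then 1 else 0)"
  proof (cases t)
    case (X j)
    then show ?thesis by auto
  next
    case (Y j)
    then show ?thesis
      using \<open>finite A\<close> by (auto simp: image_iff)
  qed
  finally show ?thesis .
qed

text \<open>
  The even product contains the smallest variable \<open>y\<^sub>0 = y\<^sub>n\<close> and the odd one does not.
\<close>

lemma revlex_even_odd:
  assumes m: "even m" "2 \<le> m" "m \<le> n"
  shows "revlex n (\<lambda>i. Y (i mod n)) (even_y n m) (odd_y n m)"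
proof -
  have "(\<Sum>i\<in>{i\<in>{0..<m}. even i}. 1 :: nat) = (\<Sum>i\<in>{i\<in>{0..<m}. odd i}. 1)"
    by (rule sum.reindex_bij_witness[of _ "\<lambda>i. i - 1" "\<lambda>i. i + 1"]) (use m in \<open>auto, presburger+\<close>)
  then have "total_deg (even_y n m) = total_deg (odd_y n m)"
    unfolding even_y_def odd_y_def total_deg_sum total_deg_ymon .
  moreover have "Poly_Mapping.lookup (even_y n m) (Y (n mod n)) = 1"
    unfolding even_y_def by (subst lookup_sum_ymon) (use m in auto)
  moreover have "Poly_Mapping.lookup (odd_y n m) (Y (n mod n)) = 0"
    unfolding odd_y_def by (subst lookup_sum_ymon) (use m in auto)
  ultimately show ?thesis
    unfolding revlex_def using m by (intro disjI2 conjI bexI[of _ n]) auto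
qed

abbreviation T_order :: "int \<Rightarrow> (monom \<Rightarrow> monom \<Rightarrow> bool) \<Rightarrow> monom \<Rightarrow> monom \<Rightarrow> bool" where
  "T_order n lt2 \<equiv> product_order (yvars n) (revlex n (\<lambda>i. Y (i mod n))) (xvars n) lt2"

lemma yvars_eq_image: "n > 0 \<Longrightarrow> yvars n = (\<lambda>i. Y (i mod n)) ` {1..n}"
proof -
  assume n: "n > 0"
  have "{0..<n} = (\<lambda>i. i mod n) ` {1..n}"
  proof
    show "{0..<n} \<subseteq> (\<lambda>i. i mod n) ` {1..n}"
    proof
      fix i assume "i \<in> {0..<n}"
      then show "i \<in> (\<lambda>i. i mod n) ` {1..n}"
        by (intro image_eqI[of _ _ "if i = 0 then n else i"]) auto
    qed
  qed (use n in auto)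
  then show ?thesis
    unfolding yvars_def by (metis image_image)
qed

lemma T_order_strict_linear:
  assumes n: "n > 0" and lt2: "monomial_order (xvars n) lt2"
  shows "irreflp_on (monoms (xvars n \<union> yvars n)) (T_order n lt2)"
    and "transp_on (monoms (xvars n \<union> yvars n)) (T_order n lt2)"
    and "totalp_on (monoms (xvars n \<union> yvars n)) (T_order n lt2)"
proof -
  have disj: "xvars n \<inter> yvars n = {}"
    by (auto simp: xvars_def yvars_def)
  note y = revlex_strict_linear[of "\<lambda>i. Y (i mod n)" n, folded yvars_eq_image[OF n]]
  have x: "irreflp_on (monoms (xvars n)) lt2" "transp_on (monoms (xvars n)) lt2"
    "totalp_on (monoms (xvars n)) lt2"
    using lt2 by (simp_all add: monomial_order_def)
  show "irreflp_on (monoms (xvars n \<union> yvars n)) (T_order n lt2)"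
    "transp_on (monoms (xvars n \<union> yvars n)) (T_order n lt2)"
    "totalp_on (monoms (xvars n \<union> yvars n)) (T_order n lt2)"
    using product_order_strict_linear[OF disj y x] by auto
qed

text \<open>
  The \<open>y\<close>-parts of the two terms of each \<open>f\<^sub>j\<close>, \<open>g\<^sub>k\<close> and \<open>h\<close> already differ, and the product
  order compares these parts first.
\<close>

lemma binomial_lead:
  assumes n: "n > 0" and lt2: "monomial_order (xvars n) lt2"
    and u: "u \<in> monoms (xvars n)" "u' \<in> monoms (xvars n)"
    and v: "v \<in> monoms (yvars n)" "v' \<in> monoms (yvars n)"
    and lt: "revlex n (\<lambda>i. Y (i mod n)) v' v"
  shows "lead_monom (T_order n lt2) (monom_poly (u + v) - monom_poly (u' + v') :: 'k::field mpoly) = u + v"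
    and "monom_poly (u + v) - monom_poly (u' + v') \<noteq> (0 :: 'k mpoly)"
proof -
  note order = T_order_strict_linear[OF n lt2]
  have mon: "u + v \<in> monoms (xvars n \<union> yvars n)" "u' + v' \<in> monoms (xvars n \<union> yvars n)"
    using u v monoms_mono[of "xvars n" "xvars n \<union> yvars n"] monoms_mono[of "yvars n" "xvars n \<union> yvars n"]
    by (auto intro!: monoms_add)
  have lt': "T_order n lt2 (u' + v') (u + v)"
    unfolding product_order_def using u v lt by blast
  show "lead_monom (T_order n lt2) (monom_poly (u + v) - monom_poly (u' + v') :: 'k mpoly) = u + v"
    by (rule lead_monom_binomial[OF order mon lt'])
  show "monom_poly (u + v) - monom_poly (u' + v') \<noteq> (0 :: 'k mpoly)"
    by (rule binomial_nonzero[OF order(1) mon(1) lt'])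
qed

lemma lead_f_poly:
  assumes "n \<ge> 2" and "monomial_order (xvars n) lt2" and "j \<in> {1..n - 1}"
  shows "lead_monom (T_order n lt2) (f_poly n j :: 'k::field mpoly) = xmon n (j - 2) + ymon n j"
    and "f_poly n j \<noteq> (0 :: 'k mpoly)"
  unfolding f_poly_eq
  by (rule binomial_lead[OF _ assms(2)];
      use assms in \<open>simp add: xmon_in_monoms ymon_in_monoms revlex_ymon_succ\<close>)+

lemma lead_g_poly:
  assumes "n \<ge> 2" and "monomial_order (xvars n) lt2" and "k \<in> {1..n div 2}"
  shows "lead_monom (T_order n lt2) (g_poly n k :: 'k::field mpoly) = xmon n (2 * k - 2) + odd_y n (2 * k)"
    and "g_poly n k \<noteq> (0 :: 'k mpoly)"
  unfolding g_poly_eq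
  by (rule binomial_lead[OF _ assms(2)]; use assms in
      \<open>auto simp: xmon_in_monoms odd_y_in_monoms even_y_in_monoms intro!: revlex_even_odd\<close>)+

lemma lead_h_poly:
  assumes "n \<ge> 2" and "even n" and "monomial_order (xvars n) lt2"
  shows "lead_monom (T_order n lt2) (h_poly n :: 'k::field mpoly) = odd_y n n"
    and "h_poly n \<noteq> (0 :: 'k mpoly)"
  using binomial_lead[of n lt2 0 0 "odd_y n n" "even_y n n", where ?'k = 'k] revlex_even_odd[of n n]
    assms by (simp_all add: h_poly_eq odd_y_in_monoms even_y_in_monoms)

section \<open>Monomials that are not minimal in their fibre\<close>

lemma divides_if_lookup_le:
  fixes l m :: monom
  assumes "\<And>t. Poly_Mapping.lookup l t \<le> Poly_Mapping.lookup m t"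
  shows "\<exists>d. m = d + l"
  by (intro exI[of _ "m - l"] poly_mapping_eqI) (simp add: lookup_add lookup_minus assms)

lemma sum_ymon_divides:
  assumes "A \<subseteq> {0..<n}" and "\<And>j. j \<in> A \<Longrightarrow> Poly_Mapping.lookup m (Y j) > 0"
  shows "\<exists>d. m = d + (\<Sum>j\<in>A. ymon n j)"
  by (rule divides_if_lookup_le) (use assms in \<open>auto simp: lookup_sum_ymon Suc_le_eq\<close>)

lemma xmon_sum_ymon_divides:
  assumes "A \<subseteq> {0..<n}" and "\<And>j. j \<in> A \<Longrightarrow> Poly_Mapping.lookup m (Y j) > 0"
    and "Poly_Mapping.lookup m (X (i mod n)) > 0"
  shows "\<exists>d. m = d + (xmon n i + (\<Sum>j\<in>A. ymon n j))"
  by (rule divides_if_lookup_le)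
    (use assms in \<open>auto simp: lookup_add lookup_sum_ymon xmon_def lookup_single when_def Suc_le_eq\<close>)

lemma total_deg_yvars:
  assumes "v \<in> monoms (yvars n)"
  shows "total_deg v = (\<Sum>j\<in>{0..<n}. Poly_Mapping.lookup v (Y j))"
proof -
  have "total_deg v = (\<Sum>t\<in>yvars n. Poly_Mapping.lookup v t)"
    unfolding total_deg_def using assms
    by (intro sum.mono_neutral_left) (auto simp: monoms_def yvars_def in_keys_iff)
  then show ?thesis
    by (simp add: yvars_def sum.reindex inj_on_def)
qed

text \<open>
  The \<open>y\<close>-parts differ, since the toric map fixes the \<open>x\<close>-part and equal \<open>y\<close>-parts would force
  \<open>m' = m\<close>. Their degrees agree because \<open>t\<close> records them. So the comparison is decided by the
  reverse lexicographic tie-break.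
\<close>

lemma smaller_in_fibre:
  assumes n: "n \<ge> 2" and lt: "T_order n lt2 m' m" and ne: "m' \<noteq> m" and eq: "weight n m' = weight n m"
  obtains i where "i \<in> {1..n}"
    and "Poly_Mapping.lookup m' (Y (i mod n)) > Poly_Mapping.lookup m (Y (i mod n))"
    and "\<And>l. l \<in> {i<..n} \<Longrightarrow> Poly_Mapping.lookup m' (Y (l mod n)) = Poly_Mapping.lookup m (Y (l mod n))"
proof -
  obtain u u' v v' where u: "u \<in> monoms (xvars n)" "u' \<in> monoms (xvars n)"
    and v: "v \<in> monoms (yvars n)" "v' \<in> monoms (yvars n)"
    and m: "m' = u + v" "m = u' + v'"
    and cases: "revlex n (\<lambda>i. Y (i mod n)) v v' \<or> v = v'"
    using lt unfolding product_order_def by blast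
  have sub: "monoms (xvars n) \<subseteq> monoms (xvars n \<union> yvars n)"
    "monoms (yvars n) \<subseteq> monoms (xvars n \<union> yvars n)"
    by (auto intro!: monoms_mono)
  have Y: "Poly_Mapping.lookup m' (Y j) = Poly_Mapping.lookup v (Y j)"
    "Poly_Mapping.lookup m (Y j) = Poly_Mapping.lookup v' (Y j)" for j
    using u by (auto simp: m lookup_add monoms_def xvars_def in_keys_iff)
  have "m \<in> monoms (xvars n \<union> yvars n)" "m' \<in> monoms (xvars n \<union> yvars n)"
    unfolding m using u v sub by (auto intro!: monoms_add)
  then have deg: "total_deg v = total_deg v'"
    using weight_fibre(1)[OF _ _ n eq] v by (simp add: total_deg_yvars Y)
  have "v \<noteq> v'"
  proof
    assume "v = v'"
    then have "weight n u = weight n u'"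
      using eq by (simp add: m weight_add)
    then show False
      using ne u \<open>v = v'\<close> by (simp add: m weight_xvars)
  qed
  with cases deg that show ?thesis
    unfolding revlex_def Y by auto
qed

text \<open>
  Put \<open>c = b' - b\<close> for the \<open>y\<close>-exponents \<open>b\<close>, \<open>b'\<close> of \<open>m\<close>, \<open>m'\<close>. As exponents of \<open>m'\<close> are nonnegative,
  \<open>y\<^sub>j\<close> divides \<open>m\<close> when \<open>c j < 0\<close>, and by the description of fibres \<open>x\<^sub>i\<close> divides \<open>m\<close> when
  \<open>c (i + 1) + c (i + 2) < 0\<close>. These are the conditions that the dichotomy for \<open>c\<close> provides.
\<close>

lemma leading_monomial_divides:
  assumes n: "n \<ge> 2" "even n" and m: "m \<in> monoms (xvars n \<union> yvars n)" "m' \<in> monoms (xvars n \<union> yvars n)"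
    and lt: "T_order n lt2 m' m" and ne: "m' \<noteq> m" and eq: "weight n m' = weight n m"
  shows "(\<exists>j\<in>{1..n - 1}. \<exists>d. m = d + (xmon n (j - 2) + ymon n j)) \<or>
    (\<exists>k\<in>{1..n div 2}. \<exists>d. m = d + (xmon n (2 * k - 2) + odd_y n (2 * k))) \<or>
    (\<exists>d. m = d + odd_y n n)"
proof -
  let ?b = "\<lambda>j. Poly_Mapping.lookup m (Y (j mod n))" and ?b' = "\<lambda>j. Poly_Mapping.lookup m' (Y (j mod n))"
  define c where "c j = int (?b' j) - int (?b j)" for j
  have pos_y: "?b j > 0" if "c j < 0" for j
    using that by (simp add: c_def)
  have pos_x: "Poly_Mapping.lookup m (X (i mod n)) > 0" if "c (i + 1) + c (i + 2) < 0" for i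
    using weight_fibre(2)[OF m n(1) eq, of i] that by (simp add: c_def)
  have "(\<Sum>j\<in>{0..<n}. c j) = int (\<Sum>j\<in>{0..<n}. Poly_Mapping.lookup m' (Y j)) -
      int (\<Sum>j\<in>{0..<n}. Poly_Mapping.lookup m (Y j))"
    by (simp add: c_def sum_subtractf)
  then have sum: "(\<Sum>j\<in>{0..<n}. c j) = 0"
    using weight_fibre(1)[OF m n(1) eq] by simp
  obtain i where i: "i \<in> {1..n}" "c i > 0" "\<forall>l\<in>{i<..n}. c l = 0"
    using smaller_in_fibre[OF n(1) lt ne eq] unfolding c_def by (metis diff_gt_0_iff_gt diff_self of_nat_less_iff)
  have periodic: "c n = c 0"
    by (simp add: c_def)
  show ?thesis
  proof (cases "\<exists>j\<in>{1..n - 1}. c j < 0 \<and> c (j - 1) + c j < 0")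
    case True
    then obtain j where j: "j \<in> {1..n - 1}" "c j < 0" "c (j - 1) + c j < 0"
      by blast
    then have "\<exists>d. m = d + (xmon n (j - 2) + (\<Sum>l\<in>{j}. ymon n l))"
      using pos_y[of j] pos_x[of "j - 2"] by (intro xmon_sum_ymon_divides) auto
    then show ?thesis
      using j(1) by auto
  next
    case False
    obtain k where k: "k \<in> {1..n div 2}" "\<forall>i\<in>{0..<2 * k}. odd i \<longrightarrow> c i < 0"
      "2 * k = n \<or> c (2 * k - 1) + c (2 * k) < 0"
      using revlex_descent_dichotomy[OF n(2,1) periodic sum i False] by blast
    have y: "Poly_Mapping.lookup m (Y i) > 0" if "i \<in> {i\<in>{0..<2 * k}. odd i}" for i
      using that k(1,2) pos_y[of i] by auto
    have sub: "{i\<in>{0..<2 * k}. odd i} \<subseteq> {0..<n}"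
      using k(1) by auto
    show ?thesis
      using k(3)
    proof
      assume "2 * k = n"
      then show ?thesis
        using sum_ymon_divides[OF sub y] by (simp add: odd_y_def)
    next
      assume "c (2 * k - 1) + c (2 * k) < 0"
      then have "\<exists>d. m = d + (xmon n (2 * k - 2) + odd_y n (2 * k))"
        unfolding odd_y_def using pos_x[of "2 * k - 2"] by (intro xmon_sum_ymon_divides sub y) auto
      then show ?thesis
        using k(1) by blast
    qed
  qed
qed

theorem corollary4p3:
  fixes n :: int and lt2 :: "monom \<Rightarrow> monom \<Rightarrow> bool"
  assumes "n \<ge> 4" and "even n" and "monomial_order (xvars n) lt2"
  shows "groebner_basis (xvars n \<union> yvars n)
           (product_order (yvars n) (revlex n (\<lambda>i. Y (i mod n))) (xvars n) lt2)
           (f_poly n ` {1..n - 1} \<union> g_poly n ` {1..n div 2} \<union> {h_poly n})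
           (set_add (T_ring n) (sym_ideal n) (HT_ideal n) :: 'k::field mpoly set)"
proof -
  have n: "n \<ge> 2" "n > 0"
    using assms(1) by auto
  show ?thesis
  proof (rule groebner_basis_in_toric_ideal[where w = "weight n",
        OF T_order_strict_linear[OF n(2) assms(3)] _ generators_in_sum_ideal[OF n(1) assms(2)]
          _ sum_ideal_subset_toric[OF n(1) assms(2)]])
    show "0 \<notin> f_poly n ` {1..n - 1} \<union> g_poly n ` {1..n div 2} \<union> {h_poly n :: 'k mpoly}"
      using lead_f_poly(2)[OF n(1) assms(3)] lead_g_poly(2)[OF n(1) assms(3)]
        lead_h_poly(2)[OF n(1) assms(2,3)] by fastforce
  next
    fix m m' assume m: "m \<in> monoms (xvars n \<union> yvars n)" "m' \<in> monoms (xvars n \<union> yvars n)"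
      "m' \<noteq> m" "weight n m' = weight n m" "T_order n lt2 m' m"
    let ?G = "f_poly n ` {1..n - 1} \<union> g_poly n ` {1..n div 2} \<union> {h_poly n :: 'k mpoly}"
    consider j d where "j \<in> {1..n - 1}" "m = d + (xmon n (j - 2) + ymon n j)"
      | k d where "k \<in> {1..n div 2}" "m = d + (xmon n (2 * k - 2) + odd_y n (2 * k))"
      | d where "m = d + odd_y n n"
      using leading_monomial_divides[OF n(1) assms(2) m(1,2,5,3,4)] by blast
    then show "\<exists>g\<in>?G. \<exists>d. m = d + lead_monom (T_order n lt2) g"
    proof cases
      case (1 j d)
      then show ?thesis
        using lead_f_poly(1)[OF n(1) assms(3) 1(1), where ?'k = 'k]
        by (intro bexI[of _ "f_poly n j"] exI[of _ d]) simp_all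
    next
      case (2 k d)
      then show ?thesis
        using lead_g_poly(1)[OF n(1) assms(3) 2(1), where ?'k = 'k]
        by (intro bexI[of _ "g_poly n k"] exI[of _ d]) simp_all
    next
      case (3 d)
      then show ?thesis
        using lead_h_poly(1)[OF n(1) assms(2,3), where ?'k = 'k]
        by (intro bexI[of _ "h_poly n"] exI[of _ d]) simp_all
    qed
  qed simp
qed

end
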